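(* A graph $G$ is a weakly threshold graph if and only if $G$ is $\{2K_2,C_4,C_5,H,\overline{H},S_3,\overline{S_3}\}$-free, i.e., no induced subgraph of $G$ is isomorphic to any of the graphs $2K_2$, $C_4$, $C_5$, $H$, $\overline{H}$, $S_3$, $\overline{S_3}$.
   Context: Graphs are finite and simple, with at least one vertex. For a degree sequence $d=(d_1,\dots,d_n)$ (terms in nonincreasing order) put $m(d)=\max\{i : d_i\ge i-1\}$ and, for $1\le k\le m(d)$, $\Delta_k(d)=k(k-1)+\sum_{i>k}\min\{k,d_i\}-\sum_{i=1}^k d_i$. A degree sequence $d$ is a weakly threshold sequence if $\Delta_k(d)\le 1$ for all $k\in\{1,\dots,m(d)\}$, and a weakly threshold graph is a graph whose degree sequence is weakly threshold. $2K_2$ is the disjoint union of two copies of $K_2$; $C_n$ is the cycle on $n$ vertices; $\overline{F}$ denotes the complement of $F$. A graph is split if its vertex set can be partitioned into a (possibly empty) clique and a (possibly empty) independent set. $H$ and $S_3$ denote, respectively, the unique (up to isomorphism) split graphs with degree sequences $(3,3,1,1,1,1)$ and $(3,3,3,1,1,1)$. *)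

theory Defs
  imports "Graph_Theory.Graph_Theory" "HOL-Library.Multiset"
begin

text \<open>A finite simple graph is a \<open>pair_graph\<close> of the library: a finite vertex set together with a
  symmetric, irreflexive set of arcs, so that each edge is represented by its two orientations.
  In particular the degree of a vertex is its in-degree.\<close>

definition degree_sequence :: "'a pair_pre_digraph \<Rightarrow> nat list" where
  "degree_sequence G =
     rev (sorted_list_of_multiset
       (image_mset (in_degree (with_proj G)) (mset_set (pverts G))))"

text \<open>Terms of a sequence are numbered from 1.\<close>

definition nth_term :: "nat list \<Rightarrow> nat \<Rightarrow> nat" where
  "nth_term d i = d ! (i - 1)"

definition seq_m :: "nat list \<Rightarrow> nat" where
  "seq_m d = Max {i \<in> {1..length d}. nth_term d i \<ge> i - 1}"

definition seq_Delta :: "nat \<Rightarrow> nat list \<Rightarrow> int" where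
  "seq_Delta k d =
     int k * (int k - 1) + (\<Sum>i\<in>{k<..length d}. min (int k) (int (nth_term d i)))
       - (\<Sum>i = 1..k. int (nth_term d i))"

definition weakly_threshold_sequence :: "nat list \<Rightarrow> bool" where
  "weakly_threshold_sequence d \<longleftrightarrow> (\<forall>k\<in>{1..seq_m d}. seq_Delta k d \<le> 1)"

definition weakly_threshold_graph :: "'a pair_pre_digraph \<Rightarrow> bool" where
  "weakly_threshold_graph G \<longleftrightarrow> weakly_threshold_sequence (degree_sequence G)"

definition family_free :: "'a pair_pre_digraph \<Rightarrow> 'b pair_pre_digraph set \<Rightarrow> bool" where
  "family_free G \<F> \<longleftrightarrow>
     \<not> (\<exists>F\<in>\<F>. \<exists>S. induced_subgraph S (with_proj G) \<and> digraph_iso (with_proj F) S)"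

definition complement_graph :: "'a pair_pre_digraph \<Rightarrow> 'a pair_pre_digraph" where
  "complement_graph G =
     \<lparr> pverts = pverts G,
       parcs = {(u, v). u \<in> pverts G \<and> v \<in> pverts G \<and> u \<noteq> v \<and> (u, v) \<notin> parcs G} \<rparr>"

definition split_graph :: "'a pair_pre_digraph \<Rightarrow> bool" where
  "split_graph G \<longleftrightarrow>
     (\<exists>K I. K \<union> I = pverts G \<and> K \<inter> I = {} \<and>
        (\<forall>u\<in>K. \<forall>v\<in>K. u \<noteq> v \<longrightarrow> (u, v) \<in> parcs G) \<and>
        (\<forall>u\<in>I. \<forall>v\<in>I. (u, v) \<notin> parcs G))"

definition graph_of :: "nat \<Rightarrow> (nat \<times> nat) set \<Rightarrow> nat pair_pre_digraph" where
  "graph_of n E = \<lparr> pverts = {..<n}, parcs = E \<union> E\<inverse> \<rparr>"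

definition two_K2 :: "nat pair_pre_digraph" where
  "two_K2 = graph_of 4 {(0, 1), (2, 3)}"

definition cycle_graph :: "nat \<Rightarrow> nat pair_pre_digraph" where
  "cycle_graph n = graph_of n ((\<lambda>i. (i, (i + 1) mod n)) ` {..<n})"

definition H_graph :: "nat pair_pre_digraph" where
  "H_graph = graph_of 6 {(0, 1), (0, 2), (0, 3), (1, 4), (1, 5)}"

definition S3_graph :: "nat pair_pre_digraph" where
  "S3_graph = graph_of 6 {(0, 1), (0, 2), (1, 2), (0, 3), (1, 4), (2, 5)}"

text \<open>\<open>H\<close> and \<open>S\<^sub>3\<close> are, up to isomorphism, the only split graphs with degree sequences
  \<open>(3,3,1,1,1,1)\<close> and \<open>(3,3,3,1,1,1)\<close>. The facts below show that the representatives
  chosen above have these properties; uniqueness is not proved here.\<close>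

lemma in_degree_graph_of:
  "in_degree (with_proj (graph_of n E)) v = card ({u. (u, v) \<in> E} \<union> {u. (v, u) \<in> E})"
proof -
  have "in_arcs (with_proj (graph_of n E)) v
      = (\<lambda>u. (u, v)) ` ({u. (u, v) \<in> E} \<union> {u. (v, u) \<in> E})"
    by (auto simp: in_arcs_def graph_of_def)
  then show ?thesis
    by (simp add: in_degree_def card_image inj_on_def)
qed

lemma pair_graph_graph_of:
  assumes "E \<subseteq> {..<n} \<times> {..<n}" "\<forall>(u, v)\<in>E. u \<noteq> v"
  shows "pair_graph (graph_of n E)"
proof -
  have "finite E"
    using assms(1) by (rule finite_subset) simp
  then show ?thesis
    using assms
    by unfold_locales (auto simp: graph_of_def symmetric_def sym_Un_converse)
qed

lemma lessThan_6: "{..<6::nat} = {0, 1, 2, 3, 4, 5}"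
  by auto

lemma H_graph:
  "pair_graph H_graph" "split_graph H_graph" "degree_sequence H_graph = [3, 3, 1, 1, 1, 1]"
proof -
  show "pair_graph H_graph"
    unfolding H_graph_def by (rule pair_graph_graph_of) simp_all
  show "split_graph H_graph"
    unfolding split_graph_def
    by (rule exI[of _ "{0, 1}"], rule exI[of _ "{2, 3, 4, 5}"])
      (auto simp: H_graph_def graph_of_def)
  have deg: "in_degree (with_proj H_graph) 0 = card {1, 2, 3::nat}"
    "in_degree (with_proj H_graph) (Suc 0) = card {0, 4, 5::nat}"
    "in_degree (with_proj H_graph) 2 = card {0::nat}"
    "in_degree (with_proj H_graph) 3 = card {0::nat}"
    "in_degree (with_proj H_graph) 4 = card {1::nat}"
    "in_degree (with_proj H_graph) 5 = card {1::nat}"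
    unfolding H_graph_def in_degree_graph_of by (rule arg_cong[of _ _ card]; auto)+
  have "pverts H_graph = {0, 1, 2, 3, 4, 5}"
    by (simp add: H_graph_def graph_of_def lessThan_6)
  then show "degree_sequence H_graph = [3, 3, 1, 1, 1, 1]"
    by (simp add: degree_sequence_def deg)
qed

lemma S3_graph:
  "pair_graph S3_graph" "split_graph S3_graph" "degree_sequence S3_graph = [3, 3, 3, 1, 1, 1]"
proof -
  show "pair_graph S3_graph"
    unfolding S3_graph_def by (rule pair_graph_graph_of) simp_all
  show "split_graph S3_graph"
    unfolding split_graph_def
    by (rule exI[of _ "{0, 1, 2}"], rule exI[of _ "{3, 4, 5}"])
      (auto simp: S3_graph_def graph_of_def)
  have deg: "in_degree (with_proj S3_graph) 0 = card {1, 2, 3::nat}"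
    "in_degree (with_proj S3_graph) (Suc 0) = card {0, 2, 4::nat}"
    "in_degree (with_proj S3_graph) 2 = card {0, 1, 5::nat}"
    "in_degree (with_proj S3_graph) 3 = card {0::nat}"
    "in_degree (with_proj S3_graph) 4 = card {1::nat}"
    "in_degree (with_proj S3_graph) 5 = card {2::nat}"
    unfolding S3_graph_def in_degree_graph_of by (rule arg_cong[of _ _ card]; auto)+
  have "pverts S3_graph = {0, 1, 2, 3, 4, 5}"
    by (simp add: S3_graph_def graph_of_def lessThan_6)
  then show "degree_sequence S3_graph = [3, 3, 3, 1, 1, 1]"
    by (simp add: degree_sequence_def deg)
qed

end

theory Submission
  imports Defs
begin

text \<open>For a set \<open>A\<close> of vertices and a vertex \<open>v\<close> outside \<open>A\<close>, say that \<open>v\<close> crosses \<open>A\<close> if it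
  misses some vertex of \<open>A\<close> and is adjacent to some vertex outside \<open>A\<close>. If \<open>A\<close> consists of the
  first \<open>k\<close> vertices in an order by nonincreasing degree, counting edges inside, across and
  outside \<open>A\<close> turns \<open>\<Delta>\<^sub>k\<close> into \<open>\<Sum>\<^bsub>u\<in>A\<^esub> |A - N(u) - u| + \<Sum>\<^bsub>v\<notin>A\<^esub> min |A - N(v)| |N(v) - A|\<close> (lemma
  \<open>seq_Delta_eq\<close>). Hence \<open>\<Delta>\<^sub>k \<le> 1\<close> says that \<open>A\<close> is a clique, that at most one vertex crosses
  it, and that this vertex does not have both two non-neighbours inside and two neighbours
  outside; the last two properties are called tameness.

  Suppose all these cuts up to \<open>m\<close> are tame cliques. A vertex outside the first \<open>m\<close> has degree
  less than \<open>m\<close>, so an edge outside would give two crossing vertices: the graph is split, which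
  excludes \<open>2K\<^sub>2\<close>, \<open>C\<^sub>4\<close> and \<open>C\<^sub>5\<close>. In a split graph the other four graphs are bipartite
  patterns between clique and independent set: \<open>H\<close> and its complement are two disjoint stars
  with two leaves, \<open>S\<^sub>3\<close> and its complement are a matching with three edges and a six-cycle.
  However the clique vertices of such a pattern are ordered, some cut between them is not tame
  (lemma \<open>no_patterns_if_tame_cuts\<close>).

  Conversely, a graph without \<open>2K\<^sub>2\<close>, \<open>C\<^sub>4\<close>, \<open>C\<^sub>5\<close> is split with an inclusion-maximal clique \<open>K\<close>
  (Foldes and Hammer, lemma \<open>split_partition_if_free\<close>). By maximality the vertices of \<open>K\<close> can be
  listed first and \<open>m \<le> |K|\<close>, so only cuts \<open>A\<close> inside \<open>K\<close> matter. Given \<open>a \<in> A\<close> and \<open>b \<in> K - A\<close>,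
  the degree order provides for each neighbour of \<open>b\<close> that \<open>a\<close> misses a neighbour of \<open>a\<close> that
  \<open>b\<close> misses; with these additional vertices any failure of tameness completes to one of the
  four patterns (lemma \<open>tame_if_no_patterns\<close>).\<close>

section \<open>Induced copies as vertex lists\<close>

text \<open>A list \<open>xs\<close> realizes a pattern on the vertices \<open>0, ..., n - 1\<close> if \<open>i \<mapsto> xs ! i\<close> is an
  isomorphism onto an induced subgraph.\<close>

definition realizes :: "'a pair_pre_digraph \<Rightarrow> 'a list \<Rightarrow> nat pair_pre_digraph \<Rightarrow> bool" where
  "realizes G xs F \<longleftrightarrow> pverts F = {..<length xs} \<and> distinct xs \<and> set xs \<subseteq> pverts G \<and>
     (\<forall>j<length xs. \<forall>i<length xs. (xs ! i, xs ! j) \<in> parcs G \<longleftrightarrow> (i, j) \<in> parcs F)"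

text \<open>A digraph isomorphism in the sense of \<open>digraph_iso\<close> also maps arcs, but the arcs of a pair
  digraph are determined by their ends, so only the map on vertices carries information.\<close>

lemma induced_copy_iff_realizes:
  assumes G: "pair_wf_digraph G" and F: "pair_wf_digraph F" and n: "pverts F = {..<n}"
  shows "(\<exists>S. induced_subgraph S (with_proj G) \<and> digraph_iso (with_proj F) S)
    \<longleftrightarrow> (\<exists>xs. realizes G xs F)"
proof
  assume "\<exists>S. induced_subgraph S (with_proj G) \<and> digraph_iso (with_proj F) S"
  then obtain S h where S: "induced_subgraph S (with_proj G)"
    and h: "pre_digraph.digraph_isomorphism (with_proj F) h" and Sh: "S = app_iso h (with_proj F)"
    by (auto simp: digraph_iso_def)
  define f where "f = iso_verts h"
  have inj: "inj_on f {..<n}"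
    and ends: "\<And>a. a \<in> parcs F \<Longrightarrow> iso_tail h (iso_arcs h a) = f (fst a)"
      "\<And>a. a \<in> parcs F \<Longrightarrow> iso_head h (iso_arcs h a) = f (snd a)"
    using h n by (auto simp: pre_digraph.digraph_isomorphism_def f_def)
  have proj: "iso_tail h = fst" "iso_head h = snd"
    and V: "f ` {..<n} \<subseteq> pverts G"
    and arcs: "iso_arcs h ` parcs F
        = {e \<in> parcs G. fst e \<in> f ` {..<n} \<and> snd e \<in> f ` {..<n}}"
    using S n unfolding Sh induced_subgraph_def subgraph_def compatible_def by (auto simp: f_def)
  have arc: "iso_arcs h a = (f (fst a), f (snd a))" if "a \<in> parcs F" for a
    using ends that proj by (metis prod.collapse)
  have "(f i, f j) \<in> parcs G \<longleftrightarrow> (i, j) \<in> parcs F" if "i < n" "j < n" for i j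
  proof
    assume "(f i, f j) \<in> parcs G"
    then have "(f i, f j) \<in> iso_arcs h ` parcs F"
      using that by (auto simp: arcs)
    then obtain k l where kl: "(k, l) \<in> parcs F" "f k = f i" "f l = f j"
      using arc by force
    moreover have "k < n" "l < n"
      using pair_wf_digraph.wellformed'[OF F kl(1)] n by auto
    ultimately show "(i, j) \<in> parcs F"
      using inj that by (metis inj_onD lessThan_iff)
  next
    assume "(i, j) \<in> parcs F"
    then have "iso_arcs h (i, j) \<in> iso_arcs h ` parcs F" by blast
    then show "(f i, f j) \<in> parcs G"
      using arc[OF \<open>(i, j) \<in> parcs F\<close>] arcs by auto
  qed
  then have "realizes G (map f [0..<n]) F"
    using inj V n by (auto simp: realizes_def distinct_map atLeast0LessThan)
  then show "\<exists>xs. realizes G xs F" ..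
next
  assume "\<exists>xs. realizes G xs F"
  then obtain xs where "realizes G xs F" ..
  then have len: "length xs = n" and dist: "distinct xs" and V: "set xs \<subseteq> pverts G"
    and adj: "\<And>i j. i < n \<Longrightarrow> j < n \<Longrightarrow> (xs ! i, xs ! j) \<in> parcs G \<longleftrightarrow> (i, j) \<in> parcs F"
    using n by (auto simp: realizes_def)
  define f where "f = (!) xs"
  define h where "h = \<lparr>iso_verts = f, iso_arcs = map_prod f f, iso_head = snd, iso_tail = fst\<rparr>"
  have inj: "inj_on f {..<n}"
    using dist len by (auto simp: inj_on_def f_def nth_eq_iff_index_eq)
  have wf: "wf_digraph (with_proj G)" "wf_digraph (with_proj F)"
    using G F by (auto intro: wf_digraph_wp_iff[THEN iffD2])
  have sub: "parcs F \<subseteq> {..<n} \<times> {..<n}"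
    using pair_wf_digraph.wellformed'[OF F] n by auto
  have iso: "pre_digraph.digraph_isomorphism (with_proj F) h"
    unfolding pre_digraph.digraph_isomorphism_def
    using wf inj n inj_on_subset[OF map_prod_inj_on[OF inj inj] sub] by (auto simp: h_def)
  have img: "f ` {..<n} = set xs"
    using len by (auto simp: f_def set_conv_nth)
  have arcs: "map_prod f f ` parcs F = {e \<in> parcs G. fst e \<in> set xs \<and> snd e \<in> set xs}"
  proof (intro equalityI subsetI)
    fix e assume "e \<in> map_prod f f ` parcs F"
    then obtain i j where ij: "(i, j) \<in> parcs F" "e = (f i, f j)" by auto
    then have "i < n" "j < n" using sub by auto
    then show "e \<in> {e \<in> parcs G. fst e \<in> set xs \<and> snd e \<in> set xs}"
      using adj[of i j] ij img by (auto simp: f_def)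
  next
    fix e assume "e \<in> {e \<in> parcs G. fst e \<in> set xs \<and> snd e \<in> set xs}"
    then obtain u v where e: "e = (u, v)" "(u, v) \<in> parcs G" "u \<in> set xs" "v \<in> set xs"
      by (cases e) auto
    then obtain i j where "i < n" "j < n" "u = f i" "v = f j"
      unfolding img[symmetric] by auto
    then show "e \<in> map_prod f f ` parcs F"
      using adj[of i j] e by (force simp: f_def)
  qed
  have "wf_digraph (app_iso h (with_proj F))"
    using wf_digraph.wf_digraphI_app_iso[OF wf(2) iso] .
  then have "induced_subgraph (app_iso h (with_proj F)) (with_proj G)"
    using wf V n img arcs
    by (auto simp: induced_subgraph_def subgraph_def compatible_def h_def)
  then show "\<exists>S. induced_subgraph S (with_proj G) \<and> digraph_iso (with_proj F) S"
    using iso by (auto simp: digraph_iso_def)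
qed

lemma realizesI:
  assumes "pair_graph G" "pair_graph F" "pverts F = {..<length xs}" "distinct xs" "set xs \<subseteq> pverts G"
    and adj: "\<And>i j. i < j \<Longrightarrow> j < length xs \<Longrightarrow> (xs ! i, xs ! j) \<in> parcs G \<longleftrightarrow> (i, j) \<in> parcs F"
  shows "realizes G xs F"
proof -
  interpret G: pair_graph G by fact
  interpret F: pair_graph F by fact
  have "(xs ! i, xs ! j) \<in> parcs G \<longleftrightarrow> (i, j) \<in> parcs F"
    if "i < length xs" "j < length xs" for i j
    using that adj[of i j] adj[of j i] G.arcs_symmetric F.arcs_symmetric
      G.pair_no_loops[of "(xs ! i, xs ! j)"] F.pair_no_loops[of "(i, j)"]
    by (cases i j rule: linorder_cases) auto
  with assms show ?thesis by (auto simp: realizes_def)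
qed

lemma pair_graph_complement:
  assumes "pair_graph G"
  shows "pair_graph (complement_graph G)"
proof -
  interpret pair_graph G by fact
  have "finite (pverts G \<times> pverts G)" by simp
  then have "finite (parcs (complement_graph G))"
    by (rule rev_finite_subset) (auto simp: complement_graph_def)
  then show ?thesis
    using arcs_symmetric
    by unfold_locales (auto simp: complement_graph_def symmetric_def intro!: symI)
qed

lemma pair_graph_two_K2: "pair_graph two_K2"
  unfolding two_K2_def by (rule pair_graph_graph_of) simp_all

lemma cycle_graph_4: "cycle_graph 4 = graph_of 4 {(0, 1), (1, 2), (2, 3), (3, 0)}"
  by (simp add: cycle_graph_def lessThan_nat_numeral lessThan_Suc insert_commute
      numeral_2_eq_2[symmetric])

lemma cycle_graph_5: "cycle_graph 5 = graph_of 5 {(0, 1), (1, 2), (2, 3), (3, 4), (4, 0)}"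
  by (simp add: cycle_graph_def lessThan_nat_numeral lessThan_Suc insert_commute
      numeral_2_eq_2[symmetric])

lemma pair_graph_C4: "pair_graph (cycle_graph 4)"
  unfolding cycle_graph_4 by (rule pair_graph_graph_of) simp_all

lemma pair_graph_C5: "pair_graph (cycle_graph 5)"
  unfolding cycle_graph_5 by (rule pair_graph_graph_of) simp_all

lemma family_free_iff_realizes:
  assumes "pair_graph G" and \<F>: "\<And>F. F \<in> \<F> \<Longrightarrow> pair_graph F" "\<And>F. F \<in> \<F> \<Longrightarrow> \<exists>n. pverts F = {..<n}"
  shows "family_free G \<F> \<longleftrightarrow> (\<forall>F\<in>\<F>. \<nexists>xs. realizes G xs F)"
proof -
  interpret pair_graph G by fact
  have "(\<exists>S. induced_subgraph S (with_proj G) \<and> digraph_iso (with_proj F) S) \<longleftrightarrow> (\<exists>xs. realizes G xs F)"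
    if F: "F \<in> \<F>" for F
  proof -
    interpret F: pair_graph F using F by (rule \<F>)
    obtain n where "pverts F = {..<n}" using \<F>(2)[OF F] by blast
    then show ?thesis
      by (rule induced_copy_iff_realizes[OF pair_wf_digraph_axioms F.pair_wf_digraph_axioms])
  qed
  then show ?thesis unfolding family_free_def by blast
qed

lemma forbidden_pair_graphs:
  "pair_graph two_K2" "pair_graph (cycle_graph 4)" "pair_graph (cycle_graph 5)" "pair_graph H_graph"
  "pair_graph (complement_graph H_graph)" "pair_graph S3_graph" "pair_graph (complement_graph S3_graph)"
  using pair_graph_two_K2 pair_graph_C4 pair_graph_C5 H_graph(1) S3_graph(1) pair_graph_complement by blast+

lemma forbidden_pverts:
  "pverts two_K2 = {..<4}" "pverts (cycle_graph 4) = {..<4}" "pverts (cycle_graph 5) = {..<5}"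
  "pverts H_graph = {..<6}" "pverts (complement_graph H_graph) = {..<6}"
  "pverts S3_graph = {..<6}" "pverts (complement_graph S3_graph) = {..<6}"
  by (simp_all add: two_K2_def cycle_graph_def H_graph_def S3_graph_def complement_graph_def graph_of_def)

lemma family_free_forbidden_iff:
  assumes "pair_graph G"
  shows "family_free G {two_K2, cycle_graph 4, cycle_graph 5,
      H_graph, complement_graph H_graph, S3_graph, complement_graph S3_graph} \<longleftrightarrow>
    (\<nexists>xs. realizes G xs two_K2) \<and> (\<nexists>xs. realizes G xs (cycle_graph 4)) \<and>
    (\<nexists>xs. realizes G xs (cycle_graph 5)) \<and>
    (\<nexists>xs. realizes G xs H_graph) \<and> (\<nexists>xs. realizes G xs (complement_graph H_graph)) \<and>
    (\<nexists>xs. realizes G xs S3_graph) \<and> (\<nexists>xs. realizes G xs (complement_graph S3_graph))"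
proof -
  have *: "\<forall>F\<in>{two_K2, cycle_graph 4, cycle_graph 5, H_graph, complement_graph H_graph, S3_graph,
      complement_graph S3_graph}. pair_graph F \<and> (\<exists>n. pverts F = {..<n})"
    by (simp add: forbidden_pair_graphs forbidden_pverts)
  from family_free_iff_realizes[OF assms *[THEN bspec, THEN conjunct1] *[THEN bspec, THEN conjunct2]]
  show ?thesis
    by (simp only: ball_simps simp_thms)
qed

section \<open>The forbidden graphs as adjacency patterns\<close>

lemma all_pairs_less:
  "(\<forall>j<4::nat. \<forall>i<j. P i j) \<longleftrightarrow> P 0 1 \<and> P 0 2 \<and> P 1 2 \<and> P 0 3 \<and> P 1 3 \<and> P 2 3"
  "(\<forall>j<5::nat. \<forall>i<j. P i j) \<longleftrightarrow> P 0 1 \<and> P 0 2 \<and> P 1 2 \<and> P 0 3 \<and> P 1 3 \<and> P 2 3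
      \<and> P 0 4 \<and> P 1 4 \<and> P 2 4 \<and> P 3 4"
  "(\<forall>j<6::nat. \<forall>i<j. P i j) \<longleftrightarrow> P 0 1 \<and> P 0 2 \<and> P 1 2 \<and> P 0 3 \<and> P 1 3 \<and> P 2 3
      \<and> P 0 4 \<and> P 1 4 \<and> P 2 4 \<and> P 3 4 \<and> P 0 5 \<and> P 1 5 \<and> P 2 5 \<and> P 3 5 \<and> P 4 5"
  by (auto simp add: numeral_eq_Suc All_less_Suc)

lemma ex_length_Suc: "(\<exists>xs. length xs = Suc n \<and> P xs) \<longleftrightarrow> (\<exists>a xs. length xs = n \<and> P (a # xs))"
  by (metis length_Suc_conv)

lemma ex_list:
  "(\<exists>xs. length xs = (4::nat) \<and> P xs) \<longleftrightarrow> (\<exists>a b c d. P [a,b,c,d])"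
  "(\<exists>xs. length xs = (5::nat) \<and> P xs) \<longleftrightarrow> (\<exists>a b c d e. P [a,b,c,d,e])"
  "(\<exists>xs. length xs = (6::nat) \<and> P xs) \<longleftrightarrow> (\<exists>a b c d e f. P [a,b,c,d,e,f])"
  by (simp_all add: numeral_eq_Suc ex_length_Suc)

context pair_graph
begin

definition adj :: "'a \<Rightarrow> 'a \<Rightarrow> bool" where
  "adj u v \<longleftrightarrow> (u, v) \<in> parcs G"

lemma adj_sym: "adj u v \<longleftrightarrow> adj v u"
  using arcs_symmetric by (auto simp: adj_def)

lemma realizes_iff:
  assumes "pair_graph F" "pverts F = {..<n}"
  shows "realizes G xs F \<longleftrightarrow> length xs = n \<and> distinct xs \<and> set xs \<subseteq> pverts G \<and>
    (\<forall>j<n. \<forall>i<j. adj (xs ! i) (xs ! j) \<longleftrightarrow> (i, j) \<in> parcs F)"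
  using assms realizesI[OF pair_graph_axioms assms(1), of xs] by (auto simp: adj_def realizes_def)

lemma two_K2_iff:
  "(\<exists>xs. realizes G xs two_K2) \<longleftrightarrow> (\<exists>a b c d. distinct [a,b,c,d] \<and> {a,b,c,d} \<subseteq> pverts G \<and>
     adj a b \<and> adj c d \<and> \<not> adj a c \<and> \<not> adj a d \<and> \<not> adj b c \<and> \<not> adj b d)"
  unfolding realizes_iff[OF forbidden_pair_graphs(1) forbidden_pverts(1)] ex_list all_pairs_less
  by (simp add: two_K2_def graph_of_def conj_ac cong: conj_cong)

lemma C4_iff:
  "(\<exists>xs. realizes G xs (cycle_graph 4)) \<longleftrightarrow> (\<exists>a b c d. distinct [a,b,c,d] \<and> {a,b,c,d} \<subseteq> pverts G \<and>
     adj a b \<and> adj b c \<and> adj c d \<and> adj a d \<and> \<not> adj a c \<and> \<not> adj b d)"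
  unfolding realizes_iff[OF forbidden_pair_graphs(2) forbidden_pverts(2)] ex_list all_pairs_less
  by (simp add: cycle_graph_4 graph_of_def conj_ac cong: conj_cong)

lemma C5_iff:
  "(\<exists>xs. realizes G xs (cycle_graph 5)) \<longleftrightarrow> (\<exists>a b c d e. distinct [a,b,c,d,e] \<and> {a,b,c,d,e} \<subseteq> pverts G \<and>
     adj a b \<and> adj b c \<and> adj c d \<and> adj d e \<and> adj a e \<and>
     \<not> adj a c \<and> \<not> adj a d \<and> \<not> adj b d \<and> \<not> adj b e \<and> \<not> adj c e)"
  unfolding realizes_iff[OF forbidden_pair_graphs(3) forbidden_pverts(3)] ex_list all_pairs_less
  by (simp add: cycle_graph_5 graph_of_def conj_ac cong: conj_cong)

lemma H_iff:
  "(\<exists>xs. realizes G xs H_graph) \<longleftrightarrow> (\<exists>a b u u' w w'. distinct [a,b,u,u',w,w'] \<and> {a,b,u,u',w,w'} \<subseteq> pverts G \<and>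
     adj a b \<and> adj a u \<and> adj a u' \<and> adj b w \<and> adj b w' \<and>
     \<not> adj a w \<and> \<not> adj a w' \<and> \<not> adj b u \<and> \<not> adj b u' \<and>
     \<not> adj u u' \<and> \<not> adj u w \<and> \<not> adj u w' \<and> \<not> adj u' w \<and> \<not> adj u' w' \<and> \<not> adj w w')"
  unfolding realizes_iff[OF forbidden_pair_graphs(4) forbidden_pverts(4)] ex_list all_pairs_less
  by (simp add: H_graph_def graph_of_def conj_ac cong: conj_cong)

lemma complement_H_iff:
  "(\<exists>xs. realizes G xs (complement_graph H_graph)) \<longleftrightarrow>
     (\<exists>a b u u' w w'. distinct [a,b,u,u',w,w'] \<and> {a,b,u,u',w,w'} \<subseteq> pverts G \<and>
     \<not> adj a b \<and> \<not> adj a u \<and> \<not> adj a u' \<and> \<not> adj b w \<and> \<not> adj b w' \<and>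
     adj a w \<and> adj a w' \<and> adj b u \<and> adj b u' \<and>
     adj u u' \<and> adj u w \<and> adj u w' \<and> adj u' w \<and> adj u' w' \<and> adj w w')"
  unfolding realizes_iff[OF forbidden_pair_graphs(5) forbidden_pverts(5)] ex_list all_pairs_less
  by (simp add: H_graph_def complement_graph_def graph_of_def conj_ac cong: conj_cong)

lemma S3_iff:
  "(\<exists>xs. realizes G xs S3_graph) \<longleftrightarrow> (\<exists>a b c u v w. distinct [a,b,c,u,v,w] \<and> {a,b,c,u,v,w} \<subseteq> pverts G \<and>
     adj a b \<and> adj a c \<and> adj b c \<and> adj a u \<and> adj b v \<and> adj c w \<and>
     \<not> adj a v \<and> \<not> adj a w \<and> \<not> adj b u \<and> \<not> adj b w \<and> \<not> adj c u \<and> \<not> adj c v \<and>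
     \<not> adj u v \<and> \<not> adj u w \<and> \<not> adj v w)"
  unfolding realizes_iff[OF forbidden_pair_graphs(6) forbidden_pverts(6)] ex_list all_pairs_less
  by (simp add: S3_graph_def graph_of_def conj_ac cong: conj_cong)

lemma complement_S3_iff:
  "(\<exists>xs. realizes G xs (complement_graph S3_graph)) \<longleftrightarrow>
     (\<exists>a b c u v w. distinct [a,b,c,u,v,w] \<and> {a,b,c,u,v,w} \<subseteq> pverts G \<and>
     \<not> adj a b \<and> \<not> adj a c \<and> \<not> adj b c \<and> \<not> adj a u \<and> \<not> adj b v \<and> \<not> adj c w \<and>
     adj a v \<and> adj a w \<and> adj b u \<and> adj b w \<and> adj c u \<and> adj c v \<and>
     adj u v \<and> adj u w \<and> adj v w)"
  unfolding realizes_iff[OF forbidden_pair_graphs(7) forbidden_pverts(7)] ex_list all_pairs_less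
  by (simp add: S3_graph_def complement_graph_def graph_of_def conj_ac cong: conj_cong)

end

section \<open>Neighbourhoods and degrees\<close>

lemma two_le_cardE:
  assumes "2 \<le> card S"
  obtains x y where "x \<in> S" "y \<in> S" "x \<noteq> y"
  using assms by (auto simp: card_le_Suc_iff numeral_2_eq_2)

lemma two_le_cardI:
  assumes "finite S" "x \<in> S" "y \<in> S" "x \<noteq> y"
  shows "2 \<le> card S"
  using assms card_mono[of S "{x, y}"] by auto

lemma two_le_card_iff:
  assumes "finite S" shows "2 \<le> card S \<longleftrightarrow> (\<exists>x\<in>S. \<exists>y\<in>S. x \<noteq> y)"
  using assms two_le_cardI two_le_cardE by metis

context pair_graph
begin

definition nbrs :: "'a \<Rightarrow> 'a set" where
  "nbrs v = {u. adj u v}"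

lemma adj_verts: "adj u v \<Longrightarrow> u \<in> pverts G" "adj u v \<Longrightarrow> v \<in> pverts G"
  using in_arcsD1 in_arcsD2 by (auto simp: adj_def)

lemma adj_irrefl: "\<not> adj u u"
  using pair_no_loops[of "(u, u)"] by (auto simp: adj_def)

lemma nbrs_subset: "nbrs v \<subseteq> pverts G" by (auto simp: nbrs_def adj_verts)
lemma finite_nbrs: "finite (nbrs v)" using nbrs_subset pair_finite_verts by (rule finite_subset)

text \<open>Removing \<open>a\<close> from the neighbours of \<open>b\<close> and \<open>b\<close> from those of \<open>a\<close> keeps the comparison of
  degrees intact, because by symmetry both or neither of them are removed. The exchange argument
  for maximal cliques and the search for forbidden patterns both rest on this.\<close>

lemma private_nbrs_card:
  assumes "card (nbrs b) \<le> card (nbrs a)"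
  shows "card (nbrs b - nbrs a - {a}) \<le> card (nbrs a - nbrs b - {b})"
proof -
  have dif: "card (nbrs x) = card (nbrs x \<inter> nbrs y) + (card (nbrs x - nbrs y - {y}) + card (nbrs x \<inter> {y}))"
    for x y
  proof -
    have "y \<notin> nbrs y" using adj_irrefl by (simp add: nbrs_def)
    have "nbrs x = (nbrs x \<inter> nbrs y) \<union> ((nbrs x - nbrs y - {y}) \<union> (nbrs x \<inter> {y}))" by auto
    then have "card (nbrs x) = card ((nbrs x \<inter> nbrs y) \<union> ((nbrs x - nbrs y - {y}) \<union> (nbrs x \<inter> {y})))"
      by (rule arg_cong)
    also have "\<dots> = card (nbrs x \<inter> nbrs y) + card ((nbrs x - nbrs y - {y}) \<union> (nbrs x \<inter> {y}))"
      using \<open>y \<notin> nbrs y\<close> finite_nbrs[of x] by (intro card_Un_disjoint) auto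
    also have "card ((nbrs x - nbrs y - {y}) \<union> (nbrs x \<inter> {y}))
      = card (nbrs x - nbrs y - {y}) + card (nbrs x \<inter> {y})"
      using finite_nbrs[of x] by (intro card_Un_disjoint) auto
    finally show ?thesis .
  qed
  have "card (nbrs a \<inter> {b}) = card (nbrs b \<inter> {a})"
    using adj_sym[of a b] by (auto simp: nbrs_def card_eq_0_iff Int_insert_right)
  then show ?thesis using assms dif[of a b] dif[of b a] by (simp add: Int_commute)
qed

lemma ex_private_nbr:
  assumes "card (nbrs b) \<le> card (nbrs a)" "adj b v" "\<not> adj a v" "v \<noteq> a"
  obtains u where "adj a u" "\<not> adj b u" "u \<noteq> b"
proof -
  have "v \<in> nbrs b - nbrs a - {a}" using assms adj_sym by (auto simp: nbrs_def)
  then have "card (nbrs b - nbrs a - {a}) > 0" by (auto simp: card_gt_0_iff finite_nbrs)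
  with private_nbrs_card[OF assms(1)] have "nbrs a - nbrs b - {b} \<noteq> {}" by force
  then show thesis using that adj_sym by (auto simp: nbrs_def)
qed

lemma ex_two_private_nbrs:
  assumes "card (nbrs b) \<le> card (nbrs a)" "adj b v" "\<not> adj a v" "v \<noteq> a"
    "adj b w" "\<not> adj a w" "w \<noteq> a" "v \<noteq> w"
  obtains u u' where "adj a u" "\<not> adj b u" "u \<noteq> b" "adj a u'" "\<not> adj b u'" "u' \<noteq> b" "u \<noteq> u'"
proof -
  have "v \<in> nbrs b - nbrs a - {a}" "w \<in> nbrs b - nbrs a - {a}"
    using assms adj_sym by (auto simp: nbrs_def)
  then have "2 \<le> card (nbrs b - nbrs a - {a})"
    using assms(8) by (intro two_le_cardI[where x = v and y = w]) (simp_all add: finite_nbrs)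
  with private_nbrs_card[OF assms(1)] have "2 \<le> card (nbrs a - nbrs b - {b})" by linarith
  then show thesis using that adj_sym by (elim two_le_cardE) (auto simp: nbrs_def)
qed

section \<open>Cuts and the differences of the degree sequence\<close>

definition crosses :: "'a set \<Rightarrow> 'a \<Rightarrow> bool" where
  "crosses A v \<longleftrightarrow> (\<exists>a\<in>A. \<not> adj a v) \<and> (\<exists>b\<in>pverts G - A. adj b v)"

definition doubly_crosses :: "'a set \<Rightarrow> 'a \<Rightarrow> bool" where
  "doubly_crosses A v \<longleftrightarrow> (\<exists>a\<in>A. \<exists>a'\<in>A. a \<noteq> a' \<and> \<not> adj a v \<and> \<not> adj a' v) \<and>
     (\<exists>b\<in>pverts G - A. \<exists>b'\<in>pverts G - A. b \<noteq> b' \<and> adj b v \<and> adj b' v)"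

definition tame :: "'a set \<Rightarrow> bool" where
  "tame A \<longleftrightarrow> (\<forall>v\<in>pverts G - A. \<forall>w\<in>pverts G - A. crosses A v \<longrightarrow> crosses A w \<longrightarrow> v = w) \<and>
     (\<forall>v\<in>pverts G - A. \<not> doubly_crosses A v)"

end

lemma sum_le_1_iff:
  fixes g :: "'b \<Rightarrow> nat"
  assumes "finite S"
  shows "sum g S \<le> 1 \<longleftrightarrow> (\<forall>v\<in>S. g v \<le> 1) \<and> (\<forall>v\<in>S. \<forall>w\<in>S. g v > 0 \<longrightarrow> g w > 0 \<longrightarrow> v = w)"
proof (intro iffI conjI ballI impI)
  assume le: "sum g S \<le> 1"
  show "g v \<le> 1" if "v \<in> S" for v
    using member_le_sum[of v S g] le assms that by simp
  show "v = w" if "v \<in> S" "w \<in> S" "g v > 0" "g w > 0" for v w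
  proof (rule ccontr)
    assume "v \<noteq> w"
    then have "g v + g w = sum g {v, w}" by simp
    also have "\<dots> \<le> sum g S" using that assms by (intro sum_mono2) auto
    finally show False using that le by linarith
  qed
next
  assume *: "(\<forall>v\<in>S. g v \<le> 1) \<and> (\<forall>v\<in>S. \<forall>w\<in>S. g v > 0 \<longrightarrow> g w > 0 \<longrightarrow> v = w)"
  show "sum g S \<le> 1"
  proof (cases "\<exists>v\<in>S. g v > 0")
    case True
    then obtain v where v: "v \<in> S" "g v > 0" by blast
    then have "sum g (S - {v}) = 0" using * by (intro sum.neutral) auto
    then show ?thesis using sum.remove[OF assms v(1), of g] * v by simp
  qed simp
qed

context pair_graph
begin

lemma in_degree_eq: "in_degree (with_proj G) v = card (nbrs v)"
proof -
  have "in_arcs (with_proj G) v = (\<lambda>u. (u, v)) ` nbrs v"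
    by (auto simp: in_arcs_def nbrs_def adj_def)
  then show ?thesis by (simp add: in_degree_def card_image inj_on_def)
qed

lemma degree_sequence_eq:
  assumes vs: "distinct vs" "set vs = pverts G"
    and sorted: "sorted_wrt (\<lambda>x y. card (nbrs y) \<le> card (nbrs x)) vs"
  shows "degree_sequence G = map (\<lambda>v. card (nbrs v)) vs"
proof -
  let ?d = "map (\<lambda>v. card (nbrs v)) vs"
  have "sorted (rev ?d)"
    using sorted by (simp add: sorted_wrt_rev sorted_wrt_map)
  then have "sort ?d = rev ?d"
    by (intro properties_for_sort) simp_all
  moreover have "image_mset (in_degree (with_proj G)) (mset_set (pverts G)) = mset ?d"
    using mset_set_set[OF vs(1)] vs(2) by (simp add: in_degree_eq[abs_def])
  ultimately show ?thesis
    by (simp only: degree_sequence_def sorted_list_of_multiset_mset rev_rev_ident)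
qed

lemma sum_nth_term:
  assumes vs: "distinct vs" "set vs = pverts G" and k: "k \<le> length vs"
  shows "(\<Sum>i = 1..k. f (nth_term (map h vs) i)) = (\<Sum>u\<in>set (take k vs). f (h u))"
    "(\<Sum>i\<in>{k<..length vs}. f (nth_term (map h vs) i)) = (\<Sum>u\<in>pverts G - set (take k vs). f (h u))"
proof -
  define g where "g i = vs ! (i - 1)" for i
  have inj: "inj_on g {1..length vs}"
    using vs(1) by (auto simp: g_def inj_on_def nth_eq_iff_index_eq)
  have img: "g ` {1..j} = set (take j vs)" if "j \<le> length vs" for j
  proof -
    have "g ` {1..j} = (!) vs ` ((\<lambda>i. i - 1) ` {1..j})" by (simp add: g_def image_image)
    also have "(\<lambda>i. i - 1) ` {1..j} = {0..<j}" by (force simp: image_iff)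
    finally show ?thesis using nth_image[OF that] by simp
  qed
  have "{k<..length vs} = {1..length vs} - {1..k}" using k by auto
  then have img2: "g ` {k<..length vs} = pverts G - set (take k vs)"
    using inj_on_image_set_diff[OF inj, of "{1..length vs}" "{1..k}"] k img[of k] img[of "length vs"] vs(2)
    by simp
  have nth: "nth_term (map h vs) i = h (g i)" if "i \<in> {1..length vs}" for i
    using that by (auto simp: nth_term_def g_def)
  have "(\<Sum>i = 1..k. f (nth_term (map h vs) i)) = (\<Sum>i = 1..k. f (h (g i)))"
    using nth k by (intro sum.cong) auto
  also have "\<dots> = (\<Sum>u\<in>g ` {1..k}. f (h u))"
    using inj_on_subset[OF inj, of "{1..k}"] k by (subst sum.reindex) auto
  finally show "(\<Sum>i = 1..k. f (nth_term (map h vs) i)) = (\<Sum>u\<in>set (take k vs). f (h u))"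
    using img k by simp
  have "(\<Sum>i\<in>{k<..length vs}. f (nth_term (map h vs) i)) = (\<Sum>i\<in>{k<..length vs}. f (h (g i)))"
    using nth by (intro sum.cong) auto
  also have "\<dots> = (\<Sum>u\<in>g ` {k<..length vs}. f (h u))"
    using inj_on_subset[OF inj, of "{k<..length vs}"] by (subst sum.reindex) (auto simp: subset_iff)
  finally show "(\<Sum>i\<in>{k<..length vs}. f (nth_term (map h vs) i)) = (\<Sum>u\<in>pverts G - set (take k vs). f (h u))"
    using img2 by simp
qed

lemma sum_crossing_edges:
  assumes "finite A" "A \<subseteq> pverts G"
  shows "(\<Sum>u\<in>A. card (nbrs u - A)) = (\<Sum>v\<in>pverts G - A. card (nbrs v \<inter> A))"
proof -
  let ?B = "pverts G - A"
  have "(\<Sum>u\<in>A. card (nbrs u - A)) = (\<Sum>u\<in>A. \<Sum>v\<in>?B. if adj u v then 1 else 0)"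
  proof (intro sum.cong refl)
    fix u
    have "nbrs u - A = {v \<in> ?B. adj u v}" using adj_sym adj_verts by (auto simp: nbrs_def)
    then show "card (nbrs u - A) = (\<Sum>v\<in>?B. if adj u v then 1 else 0)"
      by (simp add: sum.inter_filter[symmetric])
  qed
  also have "\<dots> = (\<Sum>v\<in>?B. \<Sum>u\<in>A. if adj u v then 1 else 0)" by (rule sum.swap)
  also have "\<dots> = (\<Sum>v\<in>?B. card (nbrs v \<inter> A))"
  proof (intro sum.cong refl)
    fix v
    have "nbrs v \<inter> A = {u \<in> A. adj u v}" by (auto simp: nbrs_def)
    then show "(\<Sum>u\<in>A. if adj u v then 1 else 0) = card (nbrs v \<inter> A)"
      using assms by (simp add: sum.inter_filter[symmetric])
  qed
  finally show ?thesis .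
qed

text \<open>Double counting the edges that leave \<open>A\<close> cancels the degrees. What remains are the missing
  edges inside \<open>A\<close> and, for each outer vertex, the number of its adjacencies to be changed until
  it is complete to \<open>A\<close> or has all its neighbours in \<open>A\<close>.\<close>

lemma seq_Delta_eq:
  assumes vs: "distinct vs" "set vs = pverts G" and k: "k \<le> length vs"
    and A: "A = set (take k vs)"
  shows "seq_Delta k (map (\<lambda>v. card (nbrs v)) vs) =
    int ((\<Sum>u\<in>A. card (A - nbrs u - {u})) + (\<Sum>v\<in>pverts G - A. min (card (A - nbrs v)) (card (nbrs v - A))))"
proof -
  have fin: "finite A" and sub: "A \<subseteq> pverts G" and cardA: "card A = k"
    using vs k A set_take_subset[of k vs] distinct_card[of "take k vs"] by auto
  have inside: "int (card (A - nbrs u - {u})) = (int k - 1) - int (card (nbrs u \<inter> A))" if u: "u \<in> A" for u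
  proof -
    have "u \<notin> nbrs u" using adj_irrefl by (simp add: nbrs_def)
    then have "A = insert u ((nbrs u \<inter> A) \<union> (A - nbrs u - {u}))" using u by auto
    then have "card A = card (insert u ((nbrs u \<inter> A) \<union> (A - nbrs u - {u})))" by (rule arg_cong)
    also have "\<dots> = Suc (card ((nbrs u \<inter> A) \<union> (A - nbrs u - {u})))"
      using fin \<open>u \<notin> nbrs u\<close> by (intro card_insert_disjoint) auto
    also have "card ((nbrs u \<inter> A) \<union> (A - nbrs u - {u})) = card (nbrs u \<inter> A) + card (A - nbrs u - {u})"
      using fin by (intro card_Un_disjoint) auto
    finally show ?thesis using cardA by simp
  qed
  have degree: "card (nbrs v) = card (nbrs v \<inter> A) + card (nbrs v - A)" for v
    using card_Int_Diff finite_nbrs by metis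
  have outside: "int (min (card (A - nbrs v)) (card (nbrs v - A))) =
      min (int k) (int (card (nbrs v))) - int (card (nbrs v \<inter> A))" for v
  proof -
    have "card A = card (nbrs v \<inter> A) + card (A - nbrs v)"
      using card_Int_Diff[OF fin, of "nbrs v"] by (simp add: Int_commute)
    then show ?thesis using degree[of v] cardA by simp
  qed
  have "int ((\<Sum>u\<in>A. card (A - nbrs u - {u})) + (\<Sum>v\<in>pverts G - A. min (card (A - nbrs v)) (card (nbrs v - A))))
    = (\<Sum>u\<in>A. (int k - 1) - int (card (nbrs u \<inter> A)))
    + (\<Sum>v\<in>pverts G - A. min (int k) (int (card (nbrs v))) - int (card (nbrs v \<inter> A)))"
    by (simp only: of_nat_add of_nat_sum inside outside cong: sum.cong)
  also have "\<dots> = int k * (int k - 1) - (\<Sum>u\<in>A. int (card (nbrs u \<inter> A)))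
    + ((\<Sum>v\<in>pverts G - A. min (int k) (int (card (nbrs v)))) - int (\<Sum>v\<in>pverts G - A. card (nbrs v \<inter> A)))"
    by (simp add: sum_subtractf cardA)
  also have "int (\<Sum>v\<in>pverts G - A. card (nbrs v \<inter> A)) = (\<Sum>u\<in>A. int (card (nbrs u - A)))"
    unfolding sum_crossing_edges[OF fin sub, symmetric] by simp
  also have "int k * (int k - 1) - (\<Sum>u\<in>A. int (card (nbrs u \<inter> A)))
    + ((\<Sum>v\<in>pverts G - A. min (int k) (int (card (nbrs v)))) - (\<Sum>u\<in>A. int (card (nbrs u - A))))
    = int k * (int k - 1) + (\<Sum>v\<in>pverts G - A. min (int k) (int (card (nbrs v))))
      - (\<Sum>u\<in>A. int (card (nbrs u)))"
    by (simp add: degree sum.distrib)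
  also have "\<dots> = seq_Delta k (map (\<lambda>v. card (nbrs v)) vs)"
    unfolding seq_Delta_def A length_map
    by (simp only: sum_nth_term(1)[OF vs k, where f = int]
        sum_nth_term(2)[OF vs k, where f = "\<lambda>x. min (int k) (int x)"])
  finally show ?thesis ..
qed

text \<open>Each missing edge of \<open>A\<close> counts twice, once at either end, so a value of at most 1 allows
  none.\<close>

lemma seq_Delta_le_1_iff:
  assumes vs: "distinct vs" "set vs = pverts G" and k: "k \<le> length vs"
    and A: "A = set (take k vs)"
  shows "seq_Delta k (map (\<lambda>v. card (nbrs v)) vs) \<le> 1 \<longleftrightarrow>
    (\<forall>u\<in>A. \<forall>v\<in>A. u \<noteq> v \<longrightarrow> adj u v) \<and> tame A"
proof -
  define f where "f u = card (A - nbrs u - {u})" for u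
  define g where "g v = min (card (A - nbrs v)) (card (nbrs v - A))" for v
  have fin: "finite A" by (simp add: A)
  have f_pos: "f u > 0 \<longleftrightarrow> (\<exists>v\<in>A. v \<noteq> u \<and> \<not> adj v u)" for u
    using fin by (auto simp: f_def card_gt_0_iff nbrs_def)
  have outer: "nbrs v - A = {b \<in> pverts G - A. adj b v}" for v
    using adj_verts by (auto simp: nbrs_def)
  have "card (A - nbrs v) > 0 \<longleftrightarrow> (\<exists>a\<in>A. \<not> adj a v)" for v
    using fin by (auto simp: card_gt_0_iff nbrs_def)
  moreover have "card (nbrs v - A) > 0 \<longleftrightarrow> (\<exists>b\<in>pverts G - A. adj b v)" for v
    unfolding outer by (auto simp: card_gt_0_iff)
  ultimately have g_pos: "g v > 0 \<longleftrightarrow> crosses A v" for v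
    by (simp add: g_def crosses_def)
  have "2 \<le> card (A - nbrs v) \<longleftrightarrow> (\<exists>a\<in>A. \<exists>a'\<in>A. a \<noteq> a' \<and> \<not> adj a v \<and> \<not> adj a' v)" for v
    using two_le_card_iff[of "A - nbrs v"] fin by (auto simp: nbrs_def)
  moreover have "2 \<le> card (nbrs v - A) \<longleftrightarrow>
      (\<exists>b\<in>pverts G - A. \<exists>b'\<in>pverts G - A. b \<noteq> b' \<and> adj b v \<and> adj b' v)" for v
    unfolding outer by (subst two_le_card_iff) auto
  ultimately have "2 \<le> g v \<longleftrightarrow> doubly_crosses A v" for v
    by (simp add: g_def doubly_crosses_def)
  then have g_le: "g v \<le> 1 \<longleftrightarrow> \<not> doubly_crosses A v" for v
    by (metis Suc_1 not_less_eq_eq)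
  have "sum f A + sum g (pverts G - A) \<le> 1 \<longleftrightarrow> sum f A = 0 \<and> sum g (pverts G - A) \<le> 1"
  proof (intro iffI conjI)
    assume le: "sum f A + sum g (pverts G - A) \<le> 1"
    have "\<not> f u > 0" if "u \<in> A" for u
    proof
      assume "f u > 0"
      then obtain v where v: "v \<in> A" "v \<noteq> u" "\<not> adj v u" using f_pos by blast
      then have "f v > 0" using f_pos[of v] adj_sym[of u v] that by auto
      moreover have "sum f A \<le> 1" using le by simp
      ultimately show False
        using sum_le_1_iff[OF fin, of f] v(1,2) \<open>f u > 0\<close> that by blast
    qed
    then show "sum f A = 0" by simp
  qed simp_all
  also have "sum f A = 0 \<longleftrightarrow> (\<forall>u\<in>A. \<forall>v\<in>A. u \<noteq> v \<longrightarrow> adj u v)"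
  proof -
    have "f u = 0 \<longleftrightarrow> (\<forall>v\<in>A. v \<noteq> u \<longrightarrow> adj v u)" for u
      using f_pos[of u] by auto
    then show ?thesis using fin by (auto simp: sum_eq_0_iff)
  qed
  also have "sum g (pverts G - A) \<le> 1 \<longleftrightarrow> tame A"
    by (subst sum_le_1_iff) (simp, simp only: g_le g_pos tame_def, blast)
  finally show ?thesis
    unfolding seq_Delta_eq[OF assms] f_def g_def by linarith
qed

end

section \<open>Split partitions and bipartite patterns\<close>

locale split_partition = pair_graph +
  fixes K I :: "'a set"
  assumes cover: "K \<union> I = pverts G" and disj: "K \<inter> I = {}"
    and clique: "\<And>u v. u \<in> K \<Longrightarrow> v \<in> K \<Longrightarrow> u \<noteq> v \<Longrightarrow> adj u v"
    and indep: "\<And>u v. u \<in> I \<Longrightarrow> v \<in> I \<Longrightarrow> \<not> adj u v"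
begin

text \<open>With clique vertices in the role of the centres this is \<open>H\<close>; with independent centres it
  is the complement of \<open>H\<close>. The remaining adjacencies are determined by the split partition.\<close>

definition two_cherries :: "'a set \<Rightarrow> 'a set \<Rightarrow> bool" where
  "two_cherries X Y \<longleftrightarrow> (\<exists>a\<in>X. \<exists>b\<in>X. \<exists>u\<in>Y. \<exists>u'\<in>Y. \<exists>w\<in>Y. \<exists>w'\<in>Y. u \<noteq> u' \<and> w \<noteq> w' \<and>
    adj a u \<and> adj a u' \<and> \<not> adj a w \<and> \<not> adj a w' \<and> adj b w \<and> adj b w' \<and> \<not> adj b u \<and> \<not> adj b u')"

definition induced_matching :: bool where
  "induced_matching \<longleftrightarrow> (\<exists>a\<in>K. \<exists>b\<in>K. \<exists>c\<in>K. \<exists>u\<in>I. \<exists>v\<in>I. \<exists>w\<in>I.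
    adj a u \<and> \<not> adj a v \<and> \<not> adj a w \<and> \<not> adj b u \<and> adj b v \<and> \<not> adj b w \<and> \<not> adj c u \<and> \<not> adj c v \<and> adj c w)"

text \<open>The bipartite complement of a matching with three edges, that is, a six-cycle.\<close>

definition induced_comatching :: bool where
  "induced_comatching \<longleftrightarrow> (\<exists>a\<in>K. \<exists>b\<in>K. \<exists>c\<in>K. \<exists>u\<in>I. \<exists>v\<in>I. \<exists>w\<in>I.
    \<not> adj a u \<and> adj a v \<and> adj a w \<and> adj b u \<and> \<not> adj b v \<and> adj b w \<and> adj c u \<and> adj c v \<and> \<not> adj c w)"

lemma K_or_I: "v \<in> pverts G \<Longrightarrow> v \<in> K \<or> v \<in> I" using cover by auto
lemma notK_I: "v \<in> I \<Longrightarrow> v \<notin> K" using disj by auto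
lemma K_verts: "v \<in> K \<Longrightarrow> v \<in> pverts G" using cover by auto
lemma I_verts: "v \<in> I \<Longrightarrow> v \<in> pverts G" using cover by auto

lemma no_two_K2: "\<nexists>xs. realizes G xs two_K2"
  unfolding two_K2_iff by (auto; metis K_or_I clique indep)

lemma no_C4: "\<nexists>xs. realizes G xs (cycle_graph 4)"
  unfolding C4_iff by (auto; metis K_or_I clique indep)

lemma no_C5: "\<nexists>xs. realizes G xs (cycle_graph 5)"
  unfolding C5_iff by (auto; metis K_or_I clique indep)

text \<open>The split partition of each of the next four graphs is unique, so in any induced copy the
  vertices of the clique part lie in \<open>K\<close> and the others in \<open>I\<close>.\<close>

lemma H_iff_two_cherries: "(\<exists>xs. realizes G xs H_graph) \<longleftrightarrow> two_cherries K I"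
  unfolding H_iff
proof (safe, goal_cases)
  case (1 a b u u' w w')
  then have "a \<in> K" "b \<in> K" by (auto; metis K_or_I clique indep)+
  moreover from 1 this have "u \<in> I" "u' \<in> I" "w \<in> I" "w' \<in> I" by (auto; metis K_or_I clique)+
  ultimately show ?case using 1 unfolding two_cherries_def by (auto 0 0; blast)
next
  case 2
  then obtain a b u u' w w' where *: "a \<in> K" "b \<in> K" "u \<in> I" "u' \<in> I" "w \<in> I" "w' \<in> I" "u \<noteq> u'" "w \<noteq> w'"
    "adj a u" "adj a u'" "\<not> adj a w" "\<not> adj a w'" "adj b w" "adj b w'" "\<not> adj b u" "\<not> adj b u'"
    unfolding two_cherries_def by blast
  then have "distinct [a, b, u, u', w, w']" "{a, b, u, u', w, w'} \<subseteq> pverts G"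
    using notK_I K_verts I_verts by auto
  moreover from this * have "adj a b" using clique by auto
  ultimately show ?case using * indep by blast
qed

lemma complement_H_iff_two_cherries: "(\<exists>xs. realizes G xs (complement_graph H_graph)) \<longleftrightarrow> two_cherries I K"
  unfolding complement_H_iff
proof (safe, goal_cases)
  case (1 a b w w' u u')
  then have "a \<in> I" "b \<in> I" by (auto; metis K_or_I clique indep)+
  moreover from 1 this have "u \<in> K" "u' \<in> K" "w \<in> K" "w' \<in> K" by (auto; metis K_or_I indep)+
  ultimately show ?case using 1 unfolding two_cherries_def by (auto 0 0; blast)
next
  case 2
  then obtain a b u u' w w' where *: "a \<in> I" "b \<in> I" "u \<in> K" "u' \<in> K" "w \<in> K" "w' \<in> K" "u \<noteq> u'" "w \<noteq> w'"
    "adj a u" "adj a u'" "\<not> adj a w" "\<not> adj a w'" "adj b w" "adj b w'" "\<not> adj b u" "\<not> adj b u'"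
    unfolding two_cherries_def by blast
  then have "distinct [a, b, w, w', u, u']" "{a, b, w, w', u, u'} \<subseteq> pverts G"
    using notK_I K_verts I_verts by auto
  moreover from this * have "adj w w'" "adj w u" "adj w u'" "adj w' u" "adj w' u'" "adj u u'"
    using clique by auto
  ultimately show ?case using * indep by blast
qed

lemma S3_iff_matching: "(\<exists>xs. realizes G xs S3_graph) \<longleftrightarrow> induced_matching"
  unfolding S3_iff
proof (safe, goal_cases)
  case (1 a b c u v w)
  then have "a \<in> K" "b \<in> K" "c \<in> K" by (auto; metis K_or_I clique indep)+
  moreover from 1 this have "u \<in> I" "v \<in> I" "w \<in> I" by (auto; metis K_or_I clique)+
  ultimately show ?case using 1 unfolding induced_matching_def by (auto 0 0; blast)
next
  case 2
  then obtain a b c u v w where *: "a \<in> K" "b \<in> K" "c \<in> K" "u \<in> I" "v \<in> I" "w \<in> I"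
    "adj a u" "\<not> adj a v" "\<not> adj a w" "\<not> adj b u" "adj b v" "\<not> adj b w" "\<not> adj c u" "\<not> adj c v" "adj c w"
    unfolding induced_matching_def by blast
  then have "distinct [a, b, c, u, v, w]" "{a, b, c, u, v, w} \<subseteq> pverts G"
    using notK_I K_verts I_verts by auto
  moreover from this * have "adj a b" "adj a c" "adj b c" using clique by auto
  ultimately show ?case using * indep by blast
qed

lemma complement_S3_iff_comatching: "(\<exists>xs. realizes G xs (complement_graph S3_graph)) \<longleftrightarrow> induced_comatching"
  unfolding complement_S3_iff
proof (safe, goal_cases)
  case (1 u v w a b c)
  then have "u \<in> I" "v \<in> I" "w \<in> I" by (auto; metis K_or_I clique indep)+
  moreover from 1 this have "a \<in> K" "b \<in> K" "c \<in> K" by (auto; metis K_or_I indep)+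
  ultimately show ?case using 1 adj_sym unfolding induced_comatching_def by (auto 0 0; blast)
next
  case 2
  then obtain a b c u v w where *: "a \<in> K" "b \<in> K" "c \<in> K" "u \<in> I" "v \<in> I" "w \<in> I"
    "\<not> adj a u" "adj a v" "adj a w" "adj b u" "\<not> adj b v" "adj b w" "adj c u" "adj c v" "\<not> adj c w"
    unfolding induced_comatching_def by blast
  then have "distinct [u, v, w, a, b, c]" "{u, v, w, a, b, c} \<subseteq> pverts G"
    using notK_I K_verts I_verts by auto
  moreover from this * have "adj a b" "adj a c" "adj b c" using clique by auto
  ultimately show ?case using * indep adj_sym by blast
qed

lemma two_cherriesI:
  assumes "a \<in> X" "b \<in> X" "u \<in> Y" "u' \<in> Y" "w \<in> Y" "w' \<in> Y" "u \<noteq> u'" "w \<noteq> w'"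
    "adj a u" "adj a u'" "\<not> adj a w" "\<not> adj a w'" "adj b w" "adj b w'" "\<not> adj b u" "\<not> adj b u'"
  shows "two_cherries X Y"
  unfolding two_cherries_def using assms by blast

lemma induced_matchingI:
  assumes "a \<in> K" "b \<in> K" "c \<in> K" "u \<in> I" "v \<in> I" "w \<in> I"
    "adj a u" "\<not> adj a v" "\<not> adj a w" "\<not> adj b u" "adj b v" "\<not> adj b w" "\<not> adj c u" "\<not> adj c v" "adj c w"
  shows induced_matching
  unfolding induced_matching_def using assms by blast

lemma induced_comatchingI:
  assumes "a \<in> K" "b \<in> K" "c \<in> K" "u \<in> I" "v \<in> I" "w \<in> I"
    "\<not> adj a u" "adj a v" "adj a w" "adj b u" "\<not> adj b v" "adj b w" "adj c u" "adj c v" "\<not> adj c w"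
  shows induced_comatching
  unfolding induced_comatching_def using assms by blast

section \<open>Tame cuts exclude the bipartite patterns\<close>

text \<open>The order enters only through the cuts that it induces. For two stars centred at clique
  vertices, cut between the centres; for a matching, behind the first of the three clique
  vertices; for a six-cycle, before the last one. In each case two vertices of \<open>I\<close> cross. For
  two stars centred in \<open>I\<close>, cut the four leaves two against two: either one centre crosses
  doubly, or both centres cross.\<close>

lemma no_patterns_if_tame_cuts:
  fixes r :: "'a \<Rightarrow> nat"
  assumes inj: "inj_on r K" and tame: "\<And>t. tame {x \<in> K. r x < t}"
  shows "\<not> two_cherries K I" "\<not> two_cherries I K" "\<not> induced_matching" "\<not> induced_comatching"
proof -
  have cut: False if "v \<in> I" "w \<in> I" "v \<noteq> w" "a \<in> K" "a' \<in> K" "b \<in> K" "b' \<in> K"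
    "r a < t" "r a' < t" "t \<le> r b" "t \<le> r b'" "\<not> adj a v" "adj b v" "\<not> adj a' w" "adj b' w"
    for v w a a' b b' t
  proof -
    have "v \<in> pverts G - {x \<in> K. r x < t}" "w \<in> pverts G - {x \<in> K. r x < t}"
      "b \<in> pverts G - {x \<in> K. r x < t}" "b' \<in> pverts G - {x \<in> K. r x < t}"
      using that notK_I I_verts K_verts by auto
    moreover from this have "crosses {x \<in> K. r x < t} v" "crosses {x \<in> K. r x < t} w"
      unfolding crosses_def using that by blast+
    ultimately show False using tame[of t] that unfolding tame_def by blast
  qed
  have double_cut: False if "v \<in> I" "a \<in> K" "a' \<in> K" "b \<in> K" "b' \<in> K" "a \<noteq> a'" "b \<noteq> b'"
    "r a < t" "r a' < t" "t \<le> r b" "t \<le> r b'" "\<not> adj a v" "\<not> adj a' v" "adj b v" "adj b' v"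
    for v a a' b b' t
  proof -
    have "v \<in> pverts G - {x \<in> K. r x < t}"
      "b \<in> pverts G - {x \<in> K. r x < t}" "b' \<in> pverts G - {x \<in> K. r x < t}"
      using that notK_I I_verts K_verts by auto
    moreover from this have "doubly_crosses {x \<in> K. r x < t} v"
      unfolding doubly_crosses_def using that by blast
    ultimately show False using tame[of t] unfolding tame_def by blast
  qed
  have neq: "r x \<noteq> r y" if "x \<in> K" "y \<in> K" "x \<noteq> y" for x y
    using inj that by (auto dest: inj_onD)
  show "\<not> two_cherries K I"
  proof
    assume "two_cherries K I"
    then obtain a b u u' w w' where *: "a \<in> K" "b \<in> K" "u \<in> I" "u' \<in> I" "w \<in> I" "w' \<in> I"
      "u \<noteq> u'" "w \<noteq> w'" "adj a u" "adj a u'" "\<not> adj a w" "\<not> adj a w'"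
      "adj b w" "adj b w'" "\<not> adj b u" "\<not> adj b u'"
      unfolding two_cherries_def by blast
    then have "r a \<noteq> r b" using neq by blast
    then show False
      using * cut[of w w' a a b b "r b"] cut[of u u' b b a a "r a"] by (simp; linarith)
  qed
  show "\<not> two_cherries I K"
  proof
    assume "two_cherries I K"
    \<comment> \<open>The pattern with its vertices named, to make its symmetries available.\<close>
    define P where "P a b u u' w w' \<longleftrightarrow> a \<in> I \<and> b \<in> I \<and> u \<in> K \<and> u' \<in> K \<and> w \<in> K \<and> w' \<in> K \<and>
      u \<noteq> u' \<and> w \<noteq> w' \<and> adj u a \<and> adj u' a \<and> \<not> adj w a \<and> \<not> adj w' a \<and>
      adj w b \<and> adj w' b \<and> \<not> adj u b \<and> \<not> adj u' b" for a b u u' w w'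
    from \<open>two_cherries I K\<close> obtain a b u u' w w' where *: "P a b u u' w w'"
      unfolding two_cherries_def P_def using adj_sym by blast
    have sym: "P a b u' u w w'" "P b a w w' u u'" if "P a b u u' w w'" for a b u u' w w'
      using that unfolding P_def by blast+
    have P_neq: "r u \<noteq> r u'" "r u \<noteq> r w" "r u' \<noteq> r w" if "P a b u u' w w'" for a b u u' w w'
      using that unfolding P_def by (intro neq; blast)+
    \<comment> \<open>By symmetry \<open>u\<close> may be taken to be the first of the four leaves. The cut follows the second.\<close>
    have ordered: False if "P a b u u' w w'" "r u < r u'" "r w < r w'" "r u < r w"
      for a b u u' w w'
    proof (cases "r u' < r w")
      case True
      then show False using that double_cut[of b u u' w w' "r w"] unfolding P_def by simp
    next
      case False
      then have "r w < r u'" using P_neq(3)[OF that(1)] by simp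
      moreover have "a \<noteq> b" using that(1) unfolding P_def by blast
      ultimately show False
        using that cut[of a b w u u' w' "Suc (r w)"] unfolding P_def by simp
    qed
    have pairs_ordered: False if "P a b u u' w w'" "r u < r u'" "r w < r w'" for a b u u' w w'
      using that ordered[of a b u u' w w'] ordered[of b a w w' u u'] sym P_neq(2)[OF that(1)]
      by (meson linorder_neqE_nat)
    have pair_ordered: False if "P a b u u' w w'" "r u < r u'" for a b u u' w w'
      using that pairs_ordered[of a b u u' w w'] pairs_ordered[of a b u u' w' w] sym
        P_neq(1)[OF sym(2)[OF that(1)]] by (meson linorder_neqE_nat)
    show False
      using * pair_ordered[of a b u u' w w'] pair_ordered[of a b u' u w w'] sym P_neq(1)[OF *]
      by (meson linorder_neqE_nat)
  qed
  show "\<not> induced_matching"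
  proof
    assume "induced_matching"
    then obtain a b c u v w where *: "a \<in> K" "b \<in> K" "c \<in> K" "u \<in> I" "v \<in> I" "w \<in> I"
      "adj a u" "\<not> adj a v" "\<not> adj a w" "\<not> adj b u" "adj b v" "\<not> adj b w" "\<not> adj c u" "\<not> adj c v" "adj c w"
      unfolding induced_matching_def by blast
    then have "r a \<noteq> r b" "r a \<noteq> r c" "r b \<noteq> r c"
      using neq by blast+
    moreover have "u \<noteq> v" "u \<noteq> w" "v \<noteq> w" using * by blast+
    moreover have "\<not> (r a < r b \<and> r a < r c)"
      using cut[of v w a a b c "Suc (r a)"] * \<open>v \<noteq> w\<close> by auto
    moreover have "\<not> (r b < r a \<and> r b < r c)"
      using cut[of u w b b a c "Suc (r b)"] * \<open>u \<noteq> w\<close> by auto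
    moreover have "\<not> (r c < r a \<and> r c < r b)"
      using cut[of u v c c a b "Suc (r c)"] * \<open>u \<noteq> v\<close> by auto
    ultimately show False by linarith
  qed
  show "\<not> induced_comatching"
  proof
    assume "induced_comatching"
    then obtain a b c u v w where *: "a \<in> K" "b \<in> K" "c \<in> K" "u \<in> I" "v \<in> I" "w \<in> I"
      "\<not> adj a u" "adj a v" "adj a w" "adj b u" "\<not> adj b v" "adj b w" "adj c u" "adj c v" "\<not> adj c w"
      unfolding induced_comatching_def by blast
    then have "r a \<noteq> r b" "r a \<noteq> r c" "r b \<noteq> r c"
      using neq by blast+
    moreover have "u \<noteq> v" "u \<noteq> w" "v \<noteq> w" using * by blast+
    moreover have "\<not> (r b < r a \<and> r c < r a)"
      using cut[of v w b c a a "r a"] * \<open>v \<noteq> w\<close> by auto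
    moreover have "\<not> (r a < r b \<and> r c < r b)"
      using cut[of u w a c b b "r b"] * \<open>u \<noteq> w\<close> by auto
    moreover have "\<not> (r a < r c \<and> r b < r c)"
      using cut[of u v a b c c "r c"] * \<open>u \<noteq> v\<close> by auto
    ultimately show False by linarith
  qed
qed

section \<open>A cut that is not tame contains a bipartite pattern\<close>

lemma crossing_in_I:
  assumes "A \<subseteq> K" "v \<in> pverts G - A" "crosses A v"
  shows "v \<in> I"
  using assms cover clique unfolding crosses_def by blast

text \<open>The hypothesis on degrees yields the facts \<open>swap\<close> and \<open>unique\<close> below: a neighbour \<open>v \<in> I\<close>
  of \<open>b\<close> missed by \<open>a\<close> is compensated by a private neighbour of \<open>a\<close>, and there is only one such
  \<open>v\<close> because two of them, with two compensating vertices, form two stars. A doubly crossing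
  vertex and two distinct crossing vertices are then excluded in turn; for two crossing
  vertices, the cases are whether they miss a common vertex of \<open>A\<close>, have a common neighbour in
  \<open>K - A\<close>, or neither.\<close>

lemma tame_if_no_patterns:
  assumes A: "A \<subseteq> K"
    and dom: "\<And>a b. a \<in> A \<Longrightarrow> b \<in> K - A \<Longrightarrow> card (nbrs b) \<le> card (nbrs a)"
    and noH: "\<not> two_cherries K I" and noH': "\<not> two_cherries I K"
    and noS: "\<not> induced_matching" and noS': "\<not> induced_comatching"
  shows "tame A"
proof -
  have swap: "\<exists>u\<in>I. adj a u \<and> \<not> adj b u" if hyps: "a \<in> A" "b \<in> K - A" "v \<in> I" "adj b v" "\<not> adj a v" for a b v
  proof -
    have "v \<noteq> a" using that A notK_I by blast
    then obtain u where u: "adj a u" "\<not> adj b u" "u \<noteq> b"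
      using ex_private_nbr[OF dom[OF hyps(1,2)] hyps(4,5)] by blast
    then have "u \<notin> K" using that clique by blast
    then show ?thesis using u K_or_I adj_verts by blast
  qed
  have unique: "v = w" if hyps: "a \<in> A" "b \<in> K - A" "v \<in> I" "adj b v" "\<not> adj a v"
    "w \<in> I" "adj b w" "\<not> adj a w" for a b v w
  proof (rule ccontr)
    assume "v \<noteq> w"
    have "v \<noteq> a" "w \<noteq> a" using that A notK_I by blast+
    then obtain u u' where u: "adj a u" "\<not> adj b u" "u \<noteq> b" "adj a u'" "\<not> adj b u'" "u' \<noteq> b" "u \<noteq> u'"
      using ex_two_private_nbrs[OF dom[OF hyps(1,2)] hyps(4,5) _ hyps(7,8) _ \<open>v \<noteq> w\<close>] by blast
    then have "u \<notin> K" "u' \<notin> K" using that clique by blast+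
    then have "u \<in> I" "u' \<in> I" using u K_or_I adj_verts by blast+
    with noH u that A \<open>v \<noteq> w\<close> two_cherriesI[of a K b u I u' v w] show False by auto
  qed
  have in_K: "b \<in> K - A" if "v \<in> I" "b \<in> pverts G - A" "adj b v" for b v
    using that K_or_I indep by blast
  have one: "\<not> doubly_crosses A v" if v: "v \<in> I" for v
  proof
    assume "doubly_crosses A v"
    then obtain a a' b b' where a: "a \<in> A" "a' \<in> A" "a \<noteq> a'" "\<not> adj a v" "\<not> adj a' v"
      and b: "b \<in> K - A" "b' \<in> K - A" "b \<noteq> b'" "adj b v" "adj b' v"
      unfolding doubly_crosses_def using in_K v by blast
    \<comment> \<open>Otherwise the vertices compensating \<open>v\<close> with respect to \<open>b\<close> and to \<open>b'\<close> close a six-cycle.\<close>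
    have priv: "\<exists>u\<in>I. adj c u \<and> \<not> adj b u \<and> \<not> adj b' u" if c: "c \<in> A" "\<not> adj c v" for c
    proof (rule ccontr)
      assume none: "\<not> ?thesis"
      obtain u where u: "u \<in> I" "adj c u" "\<not> adj b u" using swap[of c b v] c b v by blast
      obtain u' where u': "u' \<in> I" "adj c u'" "\<not> adj b' u'" using swap[of c b' v] c b v by blast
      have "adj b' u" "adj b u'" using none u u' by blast+
      with noS' u u' c b v A induced_comatchingI[of c b b' v u u'] show False by auto
    qed
    obtain u where u: "u \<in> I" "adj a u" "\<not> adj b u" "\<not> adj b' u" using priv a by blast
    obtain t where t: "t \<in> I" "adj a' t" "\<not> adj b t" "\<not> adj b' t" using priv a by blast
    \<comment> \<open>A vertex adjacent to both \<open>a\<close> and \<open>a'\<close> but not to \<open>b\<close> and \<open>b'\<close> forms two stars with \<open>v\<close>.\<close>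
    have "\<not> adj a' u"
      using noH' u a b v A two_cherriesI[of u I v a K a' b b'] adj_sym by auto
    moreover have "\<not> adj a t"
      using noH' t a b v A two_cherriesI[of t I v a K a' b b'] adj_sym by auto
    ultimately show False
      using noS u t a b v A induced_matchingI[of a a' b u t v] by auto
  qed
  have two: "v = w" if v: "v \<in> I" "crosses A v" and w: "w \<in> I" "crosses A w" for v w
  proof (rule ccontr)
    assume neq: "v \<noteq> w"
    obtain a b where a: "a \<in> A" "\<not> adj a v" and b: "b \<in> K - A" "adj b v"
      using v in_K unfolding crosses_def by blast
    obtain a' b' where a': "a' \<in> A" "\<not> adj a' w" and b': "b' \<in> K - A" "adj b' w"
      using w in_K unfolding crosses_def by blast
    have common_non: False if c: "c \<in> A" "\<not> adj c v" "\<not> adj c w" for c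
    proof -
      have nb: "\<not> adj b w" "\<not> adj b' v"
        using unique[of c b v w] unique[of c b' v w] c b b' v w neq by blast+
      obtain u where u: "u \<in> I" "adj c u" "\<not> adj b u" using swap[of c b v] c b v by blast
      obtain u' where u': "u' \<in> I" "adj c u'" "\<not> adj b' u'" using swap[of c b' w] c b' w by blast
      have "adj b' u"
        using noS u c b b' nb v w A induced_matchingI[of c b b' u v w] by auto
      moreover have "adj b u'"
        using noS u' c b b' nb v w A induced_matchingI[of c b b' u' v w] by auto
      ultimately show False
        using noH u u' c b b' nb v w two_cherriesI[of b K b' v I u' w u] by auto
    qed
    have common_nbr: False if c: "c \<in> K - A" "adj c v" "adj c w" for c
    proof -
      have na: "adj a w" "adj a' v" using common_non a a' by blast+
      obtain u where u: "u \<in> I" "adj a u" "\<not> adj c u" using swap[of a c v] c a v by blast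
      obtain u' where u': "u' \<in> I" "adj a' u'" "\<not> adj c u'" using swap[of a' c w] c a' w by blast
      have "\<not> adj a' u"
        using noS' u c a a' na v w A induced_comatchingI[of a a' c v w u] by auto
      moreover have "\<not> adj a u'"
        using noS' u' c a a' na v w A induced_comatchingI[of a a' c v w u'] by auto
      ultimately show False
        using noH u u' c a a' na v w A two_cherriesI[of a K a' u I w u' v] by auto
    qed
    have "adj a w" "adj a' v" "\<not> adj b w" "\<not> adj b' v"
      using common_non a a' common_nbr b b' by blast+
    then show False
      using noH' a a' b b' v w A two_cherriesI[of v I w a' K b a b'] adj_sym by auto
  qed
  have "v \<in> I" if "v \<in> pverts G - A" "doubly_crosses A v" for v
    using crossing_in_I[OF A that(1)] that(2) unfolding doubly_crosses_def crosses_def by blast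
  then show ?thesis
    unfolding tame_def using one two crossing_in_I[OF A] by blast
qed

end

section \<open>Graphs without an induced two-edge matching, four-cycle or five-cycle are split\<close>

context pair_graph
begin

text \<open>Choose a clique \<open>K\<close> that maximizes the sum of \<open>deg v + 1\<close> over its vertices. The summand 1
  makes \<open>K\<close> inclusion-maximal even in the presence of isolated vertices; the degrees make it
  stable under exchange of one vertex. Suppose \<open>x\<close> and \<open>y\<close> are adjacent outside \<open>K\<close>. The sets of
  vertices of \<open>K\<close> that they miss are comparable, since otherwise there is a \<open>C\<^sub>4\<close>, and the
  smaller one, that of \<open>x\<close> say, is a singleton \<open>{z}\<close>, since otherwise there is a \<open>2K\<^sub>2\<close>. So \<open>x\<close>
  can replace \<open>z\<close> in \<open>K\<close>, hence \<open>deg x \<le> deg z\<close>, and \<open>z\<close> has a neighbour \<open>w\<close> that \<open>x\<close> misses.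
  Then \<open>w\<close> is adjacent to \<open>y\<close>, and a vertex \<open>u\<close> of \<open>K\<close> missed by \<open>w\<close> closes the five-cycle \<open>x u
  z w y\<close>.\<close>

lemma split_partition_if_free:
  assumes no_2K2: "\<nexists>xs. realizes G xs two_K2" and no_C4: "\<nexists>xs. realizes G xs (cycle_graph 4)"
    and no_C5: "\<nexists>xs. realizes G xs (cycle_graph 5)"
  obtains K I where "split_partition G K I" "\<And>v. v \<in> I \<Longrightarrow> \<exists>u\<in>K. \<not> adj u v"
proof -
  define weight where "weight K = (\<Sum>v\<in>K. Suc (card (nbrs v)))" for K
  define cliques where "cliques = {K \<in> Pow (pverts G). \<forall>u\<in>K. \<forall>v\<in>K. u \<noteq> v \<longrightarrow> adj u v}"
  have "finite cliques" "cliques \<noteq> {}" by (auto simp: cliques_def)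
  then have "Max (weight ` cliques) \<in> weight ` cliques" by (intro Max_in) auto
  then obtain K where K: "K \<in> cliques" "Max (weight ` cliques) = weight K" by auto
  have max: "weight K' \<le> weight K" if "K' \<in> cliques" for K'
    using that \<open>finite cliques\<close> Max_ge[of "weight ` cliques" "weight K'"] K(2) by simp
  have sub: "K \<subseteq> pverts G" and clique: "\<And>u v. u \<in> K \<Longrightarrow> v \<in> K \<Longrightarrow> u \<noteq> v \<Longrightarrow> adj u v"
    using K(1) by (auto simp: cliques_def)
  have fin: "finite K" using sub pair_finite_verts by (rule finite_subset)
  define I where "I = pverts G - K"
  define missing where "missing v = {u \<in> K. \<not> adj u v}" for v
  have nonempty: "missing v \<noteq> {}" if "v \<in> I" for v
  proof
    assume "missing v = {}"
    then have "insert v K \<in> cliques"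
      using that sub clique adj_sym by (auto simp: cliques_def missing_def I_def)
    then have "weight (insert v K) \<le> weight K" by (rule max)
    then show False using that fin by (simp add: weight_def I_def)
  qed
  \<comment> \<open>With both cross edges the four vertices induce a four-cycle, with neither of them two disjoint edges.\<close>
  have P4: "\<not> (\<not> adj v x \<and> \<not> adj u y)" "\<not> (adj v x \<and> adj u y)"
    if "x \<in> I" "y \<in> I" "adj x y" "u \<in> missing x" "v \<in> missing y" "u \<noteq> v" for x y u v
  proof -
    have *: "distinct [x, y, u, v]" "{x, y, u, v} \<subseteq> pverts G" "adj u v" "\<not> adj x u" "\<not> adj y v"
      using that sub clique adj_irrefl adj_sym by (auto simp: missing_def I_def)
    show "\<not> (\<not> adj v x \<and> \<not> adj u y)"
      using no_2K2 * that(3) adj_sym unfolding two_K2_iff by blast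
    show "\<not> (adj v x \<and> adj u y)"
    proof
      assume "adj v x \<and> adj u y"
      then have "distinct [x, y, u, v] \<and> {x, y, u, v} \<subseteq> pverts G \<and>
        adj x y \<and> adj y u \<and> adj u v \<and> adj x v \<and> \<not> adj x u \<and> \<not> adj y v"
        using * that(3) adj_sym by blast
      then show False using no_C4 unfolding C4_iff by blast
    qed
  qed
  have comparable: "missing x \<subseteq> missing y \<or> missing y \<subseteq> missing x"
    if "x \<in> I" "y \<in> I" "adj x y" for x y
  proof (rule ccontr)
    assume "\<not> ?thesis"
    then obtain u v where "u \<in> missing x" "u \<notin> missing y" "v \<in> missing y" "v \<notin> missing x" by blast
    then show False using P4(2)[OF that, of u v] by (auto simp: missing_def)
  qed
  have no_edge: False if xy: "x \<in> I" "y \<in> I" "adj x y" "missing x \<subseteq> missing y" for x y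
  proof -
    obtain z where z: "z \<in> missing x" using nonempty xy by blast
    have only: "u = z" if "u \<in> missing x" for u
      using P4(1)[OF xy(1-3), of u z] that z xy(4) by (auto simp: missing_def)
    have zK: "z \<in> K" "\<not> adj z x" "\<not> adj z y" using z xy(4) by (auto simp: missing_def)
    have x_adj: "adj u x" if "u \<in> K" "u \<noteq> z" for u
      using only that by (auto simp: missing_def)
    have xK: "x \<notin> K" and yK: "y \<notin> K" using xy by (auto simp: I_def)
    have "insert x (K - {z}) \<in> cliques"
      using xy(1) sub clique x_adj adj_sym by (auto simp: cliques_def I_def)
    then have "weight (insert x (K - {z})) \<le> weight K" by (rule max)
    moreover have "weight K = Suc (card (nbrs z)) + weight (K - {z})"
      unfolding weight_def using sum.remove[OF fin zK(1)] .
    moreover have "weight (insert x (K - {z})) = Suc (card (nbrs x)) + weight (K - {z})"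
      unfolding weight_def using fin xK by (subst sum.insert) auto
    ultimately have "card (nbrs x) \<le> card (nbrs z)" by simp
    then obtain w where w: "adj z w" "\<not> adj x w" "w \<noteq> x"
      using ex_private_nbr[of x z y] xy(3) zK yK by metis
    have wK: "w \<notin> K" using x_adj[of w] w adj_sym adj_irrefl by blast
    have wI: "w \<in> I" using adj_verts(2)[OF w(1)] wK by (simp add: I_def)
    have "w \<noteq> y" using w zK by blast
    have "adj w y"
    proof (rule ccontr)
      assume "\<not> adj w y"
      then have "distinct [x, y, z, w] \<and> {x, y, z, w} \<subseteq> pverts G \<and>
        adj x y \<and> adj z w \<and> \<not> adj x z \<and> \<not> adj x w \<and> \<not> adj y z \<and> \<not> adj y w"
        using xy w zK xK yK wK wI \<open>w \<noteq> y\<close> adj_irrefl adj_sym sub by (auto simp: I_def)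
      then show False using no_2K2 unfolding two_K2_iff by blast
    qed
    obtain u where u: "u \<in> missing w" using nonempty wI by blast
    have "z \<in> missing y" "z \<notin> missing w" using z xy(4) w by (auto simp: missing_def)
    then have "u \<in> missing y" using comparable[OF wI xy(2) \<open>adj w y\<close>] u by blast
    have uK: "u \<in> K" "\<not> adj u w" "\<not> adj u y" "u \<noteq> z"
      using u \<open>u \<in> missing y\<close> \<open>z \<notin> missing w\<close> by (auto simp: missing_def)
    have edges: "adj x u" "adj u z" "adj z w" "adj w y" "adj x y"
      using x_adj uK adj_sym clique zK w xy \<open>adj w y\<close> by blast+
    have nonedges: "\<not> adj x z" "\<not> adj x w" "\<not> adj u w" "\<not> adj u y" "\<not> adj z y"
      using zK w uK adj_sym by blast+
    have "distinct [x, u, z, w, y]" "{x, u, z, w, y} \<subseteq> pverts G"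
      using uK zK xK yK wK w xy wI \<open>w \<noteq> y\<close> sub adj_irrefl by (auto simp: I_def)
    with edges nonedges show False using no_C5 unfolding C5_iff by blast
  qed
  have "split_partition G K I"
  proof
    show "K \<union> I = pverts G" "K \<inter> I = {}" using sub by (auto simp: I_def)
    show "\<not> adj x y" if "x \<in> I" "y \<in> I" for x y
    proof
      assume "adj x y"
      moreover from this have "adj y x" using adj_sym by blast
      ultimately show False
        using no_edge[of x y] no_edge[of y x] comparable[of x y] that by blast
    qed
  qed (rule clique)
  moreover have "\<exists>u\<in>K. \<not> adj u v" if "v \<in> I" for v
    using nonempty[OF that] by (auto simp: missing_def)
  ultimately show thesis by (rule that)
qed

end

section \<open>The characterization\<close>

lemma ex_list_sorted_desc:
  fixes f :: "'b \<Rightarrow> nat"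
  assumes "finite S"
  obtains xs where "distinct xs" "set xs = S" "sorted_wrt (\<lambda>x y. f y \<le> f x) xs"
proof -
  obtain ys where ys: "set ys = S" "distinct ys" using finite_distinct_list[OF assms] by blast
  have "sorted_wrt (\<lambda>x y. f x \<le> f y) (sort_key f ys)"
    using sorted_sort_key[of f ys] by (simp add: sorted_wrt_map)
  then show thesis
    using ys by (intro that[of "rev (sort_key f ys)"]) (simp_all add: sorted_wrt_rev)
qed

lemma seq_m_maximal:
  assumes "d \<noteq> []"
  shows "seq_m d \<in> {1..length d}" "nth_term d (seq_m d) \<ge> seq_m d - 1"
    "\<And>i. i \<in> {1..length d} \<Longrightarrow> i - 1 \<le> nth_term d i \<Longrightarrow> i \<le> seq_m d"
proof -
  let ?M = "{i \<in> {1..length d}. nth_term d i \<ge> i - 1}"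
  have "1 \<in> ?M" using assms by (simp add: Suc_le_eq)
  then have "Max ?M \<in> ?M" by (intro Max_in) auto
  then show "seq_m d \<in> {1..length d}" "nth_term d (seq_m d) \<ge> seq_m d - 1"
    by (simp_all add: seq_m_def)
  show "i \<le> seq_m d" if "i \<in> {1..length d}" "i - 1 \<le> nth_term d i" for i
    unfolding seq_m_def using that by (intro Max_ge) auto
qed

context pair_graph
begin

text \<open>Let \<open>K\<close> consist of the first \<open>m\<close> vertices. Each later vertex has degree less than \<open>m =
  |K|\<close> and so misses a vertex of \<open>K\<close>; the ends of an edge outside \<open>K\<close> would therefore be two
  vertices crossing \<open>K\<close>.\<close>

lemma no_patterns_if_weakly_threshold:
  assumes wt: "weakly_threshold_graph G" and ne: "pverts G \<noteq> {}"
  obtains K I where "split_partition G K I" "\<not> split_partition.two_cherries G K I"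
    "\<not> split_partition.two_cherries G I K"
    "\<not> split_partition.induced_matching G K I" "\<not> split_partition.induced_comatching G K I"
proof -
  define deg where "deg v = card (nbrs v)" for v
  obtain vs where vs: "distinct vs" "set vs = pverts G" and sorted: "sorted_wrt (\<lambda>x y. deg y \<le> deg x) vs"
    using ex_list_sorted_desc[OF pair_finite_verts] .
  define d where "d = map deg vs"
  define m where "m = seq_m d"
  have d: "degree_sequence G = d"
    using degree_sequence_eq[OF vs] sorted by (simp add: d_def deg_def)
  have "d \<noteq> []" using vs ne by (auto simp: d_def)
  note m = seq_m_maximal[OF this, folded m_def]
  have len: "length d = length vs" by (simp add: d_def)
  have cut: "(\<forall>u\<in>set (take k vs). \<forall>v\<in>set (take k vs). u \<noteq> v \<longrightarrow> adj u v) \<and> tame (set (take k vs))"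
    if "k \<in> {1..m}" for k
    using wt that m(1) seq_Delta_le_1_iff[OF vs _ refl, of k]
    by (simp add: weakly_threshold_graph_def weakly_threshold_sequence_def d m_def d_def deg_def[abs_def])
  define K where "K = set (take m vs)"
  define I where "I = pverts G - K"
  have K: "adj u v" if "u \<in> K" "v \<in> K" "u \<noteq> v" for u v
    using cut[of m] m(1) that by (auto simp: K_def)
  have tame: "tame K" using cut[of m] m(1) by (auto simp: K_def)
  have sub: "K \<subseteq> pverts G" and cardK: "card K = m"
    using vs m(1) len set_take_subset[of m vs] distinct_card[of "take m vs"] by (auto simp: K_def)
  have small: "deg v < m" if v: "v \<in> I" for v
  proof (rule ccontr)
    assume "\<not> deg v < m"
    have "v \<in> set vs" "v \<notin> set (take m vs)" using v vs by (auto simp: I_def K_def)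
    then obtain j where j: "j < length vs" "v = vs ! j" by (metis in_set_conv_nth)
    have "m \<le> j"
      using \<open>v \<notin> set (take m vs)\<close> j by (metis in_set_conv_nth length_take min_less_iff_conj not_le nth_take)
    \<comment> \<open>The term number \<open>m + 1\<close> of the sequence would be at least \<open>m\<close>, against the choice of \<open>m\<close>.\<close>
    then have "deg (vs ! j) \<le> deg (vs ! m)"
      using sorted j by (cases "m = j") (auto simp: sorted_wrt_iff_nth_less)
    moreover have "nth_term d (Suc m) = deg (vs ! m)"
      using \<open>m \<le> j\<close> j by (simp add: nth_term_def d_def)
    ultimately have "Suc m \<le> m"
      using m(3)[of "Suc m"] \<open>\<not> deg v < m\<close> j \<open>m \<le> j\<close> len by simp
    then show False by simp
  qed
  have crosses: "crosses K v" if "v \<in> I" "u \<in> I" "adj u v" for u v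
  proof -
    have "\<not> K \<subseteq> nbrs v"
      using card_mono[OF finite_nbrs, of K v] small[OF that(1)] cardK by (auto simp: deg_def)
    then show ?thesis using that by (auto simp: crosses_def nbrs_def I_def)
  qed
  have sp: "split_partition G K I"
  proof
    show "K \<union> I = pverts G" "K \<inter> I = {}" using sub by (auto simp: I_def)
    show "\<not> adj u v" if "u \<in> I" "v \<in> I" for u v
    proof
      assume uv: "adj u v"
      then have "adj v u" using adj_sym by blast
      then have "u = v"
        using tame crosses[of v u] crosses[of u v] uv that unfolding tame_def I_def by blast
      then show False using uv adj_irrefl by blast
    qed
  qed (rule K)
  interpret S: split_partition G K I by (rule sp)
  \<comment> \<open>The position in \<open>vs\<close>, so that the cuts given by \<open>r\<close> are the initial segments of \<open>vs\<close>.\<close>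
  define r where "r = the_inv_into {..<length vs} ((!) vs)"
  have inj: "inj_on ((!) vs) {..<length vs}"
    using vs(1) by (auto simp: inj_on_def nth_eq_iff_index_eq)
  have r: "r (vs ! i) = i" if "i < length vs" for i
    unfolding r_def using the_inv_into_f_f[OF inj] that by simp
  have "inj_on r K"
    using sub vs(2) r by (intro inj_onI) (metis in_set_conv_nth subsetD)
  moreover have "tame {x \<in> K. r x < t}" for t
  proof (cases "t = 0")
    case True
    then show ?thesis by (simp add: tame_def crosses_def doubly_crosses_def)
  next
    case False
    have take: "set (take j vs) = (!) vs ` {0..<j}" if "j \<le> length vs" for j
      using nth_image[OF that] by simp
    have "{x \<in> K. r x < t} = set (take (min t m) vs)"
      using m(1) len take[of m] take[of "min t m"] r by (auto simp: K_def)
    then show ?thesis using cut[of "min t m"] m(1) False by simp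
  qed
  ultimately show thesis
    using that[OF sp] S.no_patterns_if_tame_cuts[of r] by blast
qed

end

text \<open>A vertex of \<open>K\<close> has degree at least \<open>|K| - 1\<close> and, by maximality of \<open>K\<close>, a vertex of \<open>I\<close>
  has degree at most \<open>|K| - 1\<close>. Hence listing \<open>K\<close> before \<open>I\<close> is compatible with the order by
  degree, even if there are ties, and \<open>m \<le> |K|\<close>.\<close>

lemma (in split_partition) weakly_threshold_if_no_patterns:
  assumes max: "\<And>v. v \<in> I \<Longrightarrow> \<exists>u\<in>K. \<not> adj u v" and ne: "pverts G \<noteq> {}"
    and "\<not> two_cherries K I" "\<not> two_cherries I K" "\<not> induced_matching" "\<not> induced_comatching"
  shows "weakly_threshold_graph G"
proof -
  define deg where "deg v = card (nbrs v)" for v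
  have finK: "finite K" and finI: "finite I"
    using finite_subset[OF _ pair_finite_verts] cover by blast+
  have degK: "card K - 1 \<le> deg v" if "v \<in> K" for v
  proof -
    have "K - {v} \<subseteq> nbrs v" using clique that by (auto simp: nbrs_def)
    then have "card (K - {v}) \<le> deg v" unfolding deg_def by (rule card_mono[OF finite_nbrs])
    then show ?thesis using that finK by simp
  qed
  have degI: "deg v < card K" if "v \<in> I" for v
  proof -
    have "nbrs v \<subseteq> K"
    proof
      fix u assume "u \<in> nbrs v"
      then show "u \<in> K"
        using indep[of u v] K_or_I[of u] adj_verts(1)[of u v] that by (auto simp: nbrs_def)
    qed
    then have "nbrs v \<subset> K" using max[OF that] by (auto simp: nbrs_def)
    then show ?thesis unfolding deg_def by (rule psubset_card_mono[OF finK])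
  qed
  obtain ks where ks: "distinct ks" "set ks = K" "sorted_wrt (\<lambda>x y. deg y \<le> deg x) ks"
    using ex_list_sorted_desc[OF finK] .
  obtain ls where ls: "distinct ls" "set ls = I" "sorted_wrt (\<lambda>x y. deg y \<le> deg x) ls"
    using ex_list_sorted_desc[OF finI] .
  define vs where "vs = ks @ ls"
  have vs: "distinct vs" "set vs = pverts G"
    using ks ls disj cover by (auto simp: vs_def)
  have sorted: "sorted_wrt (\<lambda>x y. deg y \<le> deg x) vs"
    using ks ls degK degI by (fastforce simp: vs_def sorted_wrt_append)
  define d where "d = map deg vs"
  have d: "degree_sequence G = d"
    using degree_sequence_eq[OF vs] sorted by (simp add: d_def deg_def)
  have "d \<noteq> []" using vs ne by (auto simp: d_def)
  have lenK: "length ks = card K" using ks distinct_card by fastforce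
  have "seq_m d \<le> card K"
  proof (rule ccontr)
    assume less: "\<not> seq_m d \<le> card K"
    have "seq_m d - 1 < length vs" "seq_m d - 1 \<le> deg (vs ! (seq_m d - 1))"
      using seq_m_maximal(1,2)[OF \<open>d \<noteq> []\<close>] by (auto simp: nth_term_def d_def)
    moreover have "vs ! (seq_m d - 1) \<in> I"
      using less calculation(1) lenK ls(2) nth_mem[of "seq_m d - 1 - length ks" ls]
      by (auto simp: vs_def nth_append)
    ultimately show False using degI less by fastforce
  qed
  moreover have "seq_Delta k d \<le> 1" if k: "k \<in> {1..card K}" for k
  proof -
    define A where "A = set (take k vs)"
    have take: "take k vs = take k ks" using k lenK by (simp add: vs_def)
    have "A \<subseteq> K" using ks(2) set_take_subset[of k ks] by (simp add: A_def take)
    moreover have "card (nbrs b) \<le> card (nbrs a)" if "a \<in> A" "b \<in> K - A" for a b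
    proof -
      have "ks = take k ks @ drop k ks" by simp
      then have "\<forall>x\<in>set (take k ks). \<forall>y\<in>set (drop k ks). deg y \<le> deg x"
        using ks(3) sorted_wrt_append by metis
      moreover have "b \<in> set (drop k ks)"
        using that ks(2) set_append[of "take k ks" "drop k ks"] by (auto simp: A_def take)
      ultimately show ?thesis using that by (simp add: A_def take deg_def)
    qed
    ultimately have "tame A" using tame_if_no_patterns assms(3-6) by blast
    moreover have "k \<le> length vs" using k lenK by (simp add: vs_def)
    ultimately show ?thesis
      using seq_Delta_le_1_iff[OF vs _ refl, of k] \<open>A \<subseteq> K\<close> clique
      by (auto simp: d_def deg_def[abs_def] A_def)
  qed
  ultimately show ?thesis
    by (simp add: weakly_threshold_graph_def weakly_threshold_sequence_def d)
qed

theorem theorem4p1: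
  fixes G :: "'a pair_pre_digraph"
  assumes "pair_graph G"
    and "pverts G \<noteq> {}"
  shows "weakly_threshold_graph G \<longleftrightarrow>
    family_free G {two_K2, cycle_graph 4, cycle_graph 5,
      H_graph, complement_graph H_graph, S3_graph, complement_graph S3_graph}"
proof -
  interpret pair_graph G by fact
  show ?thesis
    unfolding family_free_forbidden_iff[OF assms(1)]
  proof
    assume "weakly_threshold_graph G"
    then obtain K I where sp: "split_partition G K I"
      and none: "\<not> split_partition.two_cherries G K I" "\<not> split_partition.two_cherries G I K"
        "\<not> split_partition.induced_matching G K I" "\<not> split_partition.induced_comatching G K I"
      using no_patterns_if_weakly_threshold assms(2) by blast
    interpret split_partition G K I by (rule sp)
    show "(\<nexists>xs. realizes G xs two_K2) \<and> (\<nexists>xs. realizes G xs (cycle_graph 4)) \<and>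
    (\<nexists>xs. realizes G xs (cycle_graph 5)) \<and>
    (\<nexists>xs. realizes G xs H_graph) \<and> (\<nexists>xs. realizes G xs (complement_graph H_graph)) \<and>
    (\<nexists>xs. realizes G xs S3_graph) \<and> (\<nexists>xs. realizes G xs (complement_graph S3_graph))"
      using none unfolding H_iff_two_cherries complement_H_iff_two_cherries S3_iff_matching
        complement_S3_iff_comatching
      by (intro conjI no_two_K2 no_C4 no_C5)
  next
    assume free: "(\<nexists>xs. realizes G xs two_K2) \<and> (\<nexists>xs. realizes G xs (cycle_graph 4)) \<and>
    (\<nexists>xs. realizes G xs (cycle_graph 5)) \<and>
    (\<nexists>xs. realizes G xs H_graph) \<and> (\<nexists>xs. realizes G xs (complement_graph H_graph)) \<and>
    (\<nexists>xs. realizes G xs S3_graph) \<and> (\<nexists>xs. realizes G xs (complement_graph S3_graph))"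
    then obtain K I where sp: "split_partition G K I" and max: "\<And>v. v \<in> I \<Longrightarrow> \<exists>u\<in>K. \<not> adj u v"
      using split_partition_if_free by metis
    interpret split_partition G K I by (rule sp)
    show "weakly_threshold_graph G"
      using free weakly_threshold_if_no_patterns[OF max assms(2)]
      unfolding H_iff_two_cherries complement_H_iff_two_cherries S3_iff_matching
        complement_S3_iff_comatching by blast
  qed
qed

end
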